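(* Let $q=3^n$ with $n\ge1$ and let \[ f(X)=X+\frac{aX^2+bX+c}{X^3+X^2+e}\in\mathbb F_q(X), \] where $a,b,c,e\in\mathbb F_q$, $a,b,c$ are not all $0$, and $X^3+X^2+e$ is irreducible over $\mathbb F_q$. If $n>4$, then $f$ is a permutation rational function of $\mathbb P^1(\mathbb F_q)$ if and only if $a=1$ and $b=c=0$. Moreover, for every $n>0$, the conditions $a=1$, $b=c=0$ imply that $f$ is a permutation rational function of $\mathbb P^1(\mathbb F_q)$.
   Context: $\mathbb P^1(\mathbb F_q)=\mathbb F_q\cup\{\infty\}$. A rational function $f=P/Q\in\mathbb F_q(X)$ with $P,Q\in\mathbb F_q[X]$ coprime defines a map $\mathbb P^1(\mathbb F_q)\to\mathbb P^1(\mathbb F_q)$ in the usual way: $f(x)=P(x)/Q(x)$ if $Q(x)\neq0$, $f(x)=\infty$ if $Q(x)=0$, and $f(\infty)=\lim_{x\to\infty}P(x)/Q(x)$ (equal to $\infty$ when $\deg P>\deg Q$). Such an $f$ is called a permutation rational function of $\mathbb P^1(\mathbb F_q)$ if this map is a bijection. *)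

theory Defs
  imports
    "HOL-Library.Cardinality"
    "HOL-Computational_Algebra.Computational_Algebra"
begin

hide_const (open) Rat.Fract

datatype 'a proj_line = Finite 'a | Infinity

text \<open>
  The map on the projective line given by a numerator \<open>P\<close> and a denominator \<open>Q\<close>, intended for
  coprime \<open>P\<close>, \<open>Q\<close> with \<open>Q \<noteq> 0\<close>. If \<open>degree P \<le> degree Q\<close>, the limit at infinity is the quotient
  of the coefficients of degree \<open>degree Q\<close>; it is \<open>0\<close> when \<open>degree P < degree Q\<close>.
\<close>

fun quot_map :: "'a::field poly \<Rightarrow> 'a poly \<Rightarrow> 'a proj_line \<Rightarrow> 'a proj_line" where
  "quot_map P Q (Finite x) =
     (if poly Q x \<noteq> 0 then Finite (poly P x / poly Q x) else Infinity)"
| "quot_map P Q Infinity =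
     (if degree P > degree Q then Infinity
      else Finite (coeff P (degree Q) / coeff Q (degree Q)))"

text \<open>
  A rational function is an element of the fraction field of \<open>'a poly\<close>. The result does not
  depend on the choice of the coprime representation, see \<open>ratfun_map_Fract\<close> below.
\<close>

definition ratfun_map :: "'a::field poly fract \<Rightarrow> 'a proj_line \<Rightarrow> 'a proj_line" where
  "ratfun_map f =
     (let (P, Q) = (SOME (P, Q). coprime P Q \<and> Q \<noteq> 0 \<and> f = Fract P Q) in quot_map P Q)"

definition permutation_ratfun :: "'a::{field, finite} poly fract \<Rightarrow> bool" where
  "permutation_ratfun f \<longleftrightarrow> bij (ratfun_map f)"

lemma quot_map_smult:
  assumes "u \<noteq> 0"
  shows "quot_map (smult u P) (smult u Q) = quot_map P Q"
proof
  fix x show "quot_map (smult u P) (smult u Q) x = quot_map P Q x"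
    using assms by (cases x) auto
qed

lemma coprime_dvd_mult_poly:
  fixes P Q S :: "'a::field poly"
  assumes "coprime P Q" "Q \<noteq> 0" "Q dvd P * S"
  shows "Q dvd S"
proof -
  define I where "I D \<longleftrightarrow> D \<noteq> 0 \<and> (\<exists>A B. D = A * P + B * Q)" for D
  have "Q = 0 * P + 1 * Q" by simp
  then have "I Q" using assms(2) unfolding I_def by blast
  then obtain D where D: "I D" and least: "\<And>E. degree E < degree D \<Longrightarrow> \<not> I E"
    using ex_has_least_nat[of I Q degree] by (meson not_le)
  from D obtain A B where D0: "D \<noteq> 0" and AB: "D = A * P + B * Q"
    unfolding I_def by blast
  have dvd: "D dvd X * P + Y * Q" for X Y
  proof (rule ccontr)
    let ?Z = "X * P + Y * Q"
    assume "\<not> D dvd ?Z"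
    then have nz: "?Z mod D \<noteq> 0" by (simp add: dvd_eq_mod_eq_0)
    have "?Z mod D = ?Z - (?Z div D) * D" by (simp add: minus_div_mult_eq_mod)
    also have "\<dots> = (X - (?Z div D) * A) * P + (Y - (?Z div D) * B) * Q"
      by (subst (2) AB) (simp only: algebra_simps)
    finally have "I (?Z mod D)" using nz unfolding I_def by blast
    moreover have "degree (?Z mod D) < degree D" using nz D0 degree_mod_less by blast
    ultimately show False using least by blast
  qed
  have "is_unit D"
    using coprime_common_divisor[OF assms(1)] dvd[of 1 0] dvd[of 0 1] by simp
  have "Q dvd A * (P * S) + B * S * Q" using assms(3) by simp
  also have "A * (P * S) + B * S * Q = D * S" by (simp add: AB algebra_simps)
  finally show ?thesis using \<open>is_unit D\<close> by (simp add: dvd_mult_unit_iff')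
qed

lemma coprime_fract_unique:
  fixes P Q R S :: "'a::field poly"
  assumes "coprime P Q" "coprime R S" "Q \<noteq> 0" "S \<noteq> 0" "Fract P Q = Fract R S"
  obtains u where "u \<noteq> 0" "R = smult u P" "S = smult u Q"
proof -
  have eq: "P * S = R * Q"
    using assms(3-5) by (simp add: eq_fract)
  have "Q dvd P * S" by (simp add: eq)
  then have 1: "Q dvd S"
    using assms(1,3) coprime_dvd_mult_poly by blast
  have "S dvd R * Q" by (simp flip: eq)
  then have 2: "S dvd Q"
    using assms(2,4) coprime_dvd_mult_poly by blast
  from 1 obtain w where w: "S = Q * w" by (elim dvdE)
  from 2 obtain v where v: "Q = S * v" by (elim dvdE)
  have "Q * (w * v) = Q * 1" using w v by (metis mult.assoc mult.right_neutral)
  then have "w * v = 1" using assms(3) by (simp only: mult_cancel_left) simp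
  then have "is_unit w" by (metis dvd_triv_left)
  then obtain u where u: "w = [:u:]" "u \<noteq> 0"
    by (metis is_unit_poly_iff not_is_unit_0 pCons_0_0)
  have "Q * (P * w) = Q * R" using eq w by (simp add: ac_simps)
  then have "R = P * w" using assms(3) by simp
  with u w that show ?thesis by simp
qed

lemma ratfun_map_Fract:
  assumes "coprime P Q" "Q \<noteq> 0"
  shows "ratfun_map (Fract P Q) = quot_map P Q"
proof -
  define T where "T = (SOME (R, S). coprime R S \<and> S \<noteq> 0 \<and> Fract P Q = Fract R S)"
  have "case T of (R, S) \<Rightarrow> coprime R S \<and> S \<noteq> 0 \<and> Fract P Q = Fract R S"
    unfolding T_def by (rule someI[where x = "(P, Q)"]) (use assms in simp)
  then obtain R S where T: "T = (R, S)" "coprime R S" "S \<noteq> 0" "Fract P Q = Fract R S"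
    by (cases T) auto
  from coprime_fract_unique[OF assms(1) T(2) assms(2) T(3,4)]
  obtain u where "u \<noteq> 0" "R = smult u P" "S = smult u Q" .
  then show ?thesis
    using T(1) unfolding ratfun_map_def T_def by (simp add: quot_map_smult)
qed

end

theory Submission
  imports Defs
begin

text \<open>
  The value at infinity being infinity, \<open>f\<close> permutes the projective line iff it permutes the field.

  For \<open>a = 1\<close>, \<open>b = c = 0\<close>, the expression \<open>(f x - f y) / (x - y)\<close> is up to a nonzero factor the resultant
  of \<open>t\<^sup>3 + t\<^sup>2 + e\<close> and \<open>t\<^sup>2 - (x + y - 1) t + x y\<close>. If it vanished, a quadratic polynomial over the field
  would share a root with the irreducible cubic.

  Conversely, irreducibility means \<open>e = - g\<^sup>2\<close> with \<open>g\<close> of absolute trace one, and \<open>x = g / z\<close> turns the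
  denominator into the Artin-Schreier polynomial \<open>D z = z\<^sup>3 - z - g\<close>. If \<open>f\<close> permutes the field, then
  the power sums of the values, shifted by \<open>\<beta> = b / g\<close>, with exponents \<open>1, 2, 4, 5, 7\<close> vanish. They are linear combinations of the
  sums of \<open>z\<^sup>j / (D z)\<^sup>m\<close>, which are Laurent polynomials in \<open>g\<close> over the prime field. Exponent \<open>1\<close> gives
  \<open>c = - b g\<close>, and the other four equations in \<open>a\<close>, \<open>\<beta>\<close> and \<open>g\<close> have no common solution with \<open>\<beta> \<noteq> 0\<close>.
\<close>

section \<open>Power sums and traces\<close>

lemma of_nat_card_eq_0: "of_nat CARD('a::{ring_1, finite}) = (0::'a)"
proof -
  have "(\<Sum>x\<in>(UNIV::'a set). x) = (\<Sum>x\<in>UNIV. x + 1)"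
    by (rule sum.reindex_bij_witness[of _ "\<lambda>x. x + 1" "\<lambda>x. x - 1"]) auto
  then show ?thesis by (simp add: sum.distrib)
qed

lemma power_card_eq_self:
  fixes x :: "'a::{field, finite}"
  shows "x ^ CARD('a) = x"
proof (cases "x = 0")
  case False
  have "(\<Prod>y\<in>UNIV - {0}. x * y) = (\<Prod>y\<in>UNIV - {0}. y)"
    by (rule prod.reindex_bij_witness[of _ "\<lambda>y. y / x" "\<lambda>y. x * y"]) (use False in auto)
  then have "x ^ (CARD('a) - 1) = 1"
    by (simp add: prod.distrib)
  then have "x * x ^ (CARD('a) - 1) = x" by simp
  moreover have "Suc (CARD('a) - 1) = CARD('a)" by simp
  ultimately show ?thesis by (metis power_Suc)
qed simp

lemma power_card_minus_1:
  fixes x :: "'a::{field, finite}"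
  assumes "x \<noteq> 0"
  shows "x ^ (CARD('a) - 1) = 1"
proof -
  have "Suc (CARD('a) - 1) = CARD('a)" by simp
  then have "x * x ^ (CARD('a) - 1) = x"
    by (metis power_Suc power_card_eq_self)
  then show ?thesis using assms by simp
qed

text \<open>Substituting \<open>u * x\<close> for \<open>x\<close> multiplies the sum by
  \<open>u ^ k\<close>. A nonzero \<open>u\<close> with \<open>u ^ k \<noteq> 1\<close> exists
  because \<open>X ^ k - 1\<close> has at most \<open>k\<close> roots, fewer than there are nonzero
  elements.\<close>

lemma sum_power_eq_0:
  fixes k :: nat
  assumes "0 < k" "k < CARD('a::{field, finite}) - 1"
  shows "(\<Sum>x\<in>UNIV. (x::'a) ^ k) = 0"
proof -
  define p :: "'a poly" where "p = monom 1 k - 1"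
  have "coeff p k = 1" using assms(1) by (simp add: p_def)
  then have p0: "p \<noteq> 0" by auto
  have "degree p \<le> k" unfolding p_def by (rule degree_diff_le) (auto simp: degree_monom_le)
  then have "card {x. poly p x = 0} < card (UNIV - {0::'a})"
    using card_poly_roots_bound[OF p0] assms(2) by (simp add: card_Diff_singleton)
  then have "\<not> UNIV - {0} \<subseteq> {x. poly p x = 0}"
    by (meson card_mono finite leD)
  then obtain u where "u \<noteq> 0" "poly p u \<noteq> 0" by blast
  then have u: "u \<noteq> 0" "u ^ k \<noteq> 1" by (auto simp: p_def poly_monom)
  have "(\<Sum>x\<in>UNIV. x ^ k) = (\<Sum>x\<in>UNIV. (u * x) ^ k)"
    by (rule sum.reindex_bij_witness[of _ "\<lambda>x. u * x" "\<lambda>x. x / u"]) (use u in auto)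
  also have "\<dots> = u ^ k * (\<Sum>x\<in>UNIV. x ^ k)"
    by (simp add: power_mult_distrib sum_distrib_left)
  finally show ?thesis using u(2) by (metis mult_cancel_right1)
qed

lemma sum_power_card_minus_1:
  "(\<Sum>x\<in>UNIV. (x::'a::{field, finite}) ^ (CARD('a) - 1)) = -1"
proof -
  have ge2: "2 \<le> CARD('a)"
    using card_mono[of "UNIV :: 'a set" "{0, 1}"] by simp
  have "(\<Sum>x\<in>UNIV. (x::'a) ^ (CARD('a) - 1)) = (\<Sum>x\<in>UNIV - {0}. (x::'a) ^ (CARD('a) - 1))"
    by (rule sum.mono_neutral_right) (use ge2 in auto)
  also have "\<dots> = (\<Sum>x\<in>UNIV - {0::'a}. 1)"
    by (rule sum.cong) (use power_card_minus_1 in auto)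
  also have "\<dots> = of_nat CARD('a) - 1"
    using ge2 by (simp add: card_Diff_singleton of_nat_diff)
  finally show ?thesis by (simp add: of_nat_card_eq_0)
qed

text \<open>The range covers the sum of two exponents below \<open>CARD('a) - 1\<close>, as it
  arises when the trace or its square is multiplied by a power of the argument. Larger exponents are
  folded back by \<open>x ^ CARD('a) = x\<close>.\<close>

lemma sum_power_less:
  fixes k :: nat
  assumes "0 < k" "k < 2 * (CARD('a::{field, finite}) - 1)"
  shows "(\<Sum>x\<in>UNIV. (x::'a) ^ k) = (if k = CARD('a) - 1 then -1 else 0)"
proof (cases k "CARD('a) - 1" rule: linorder_cases)
  case less
  then show ?thesis using sum_power_eq_0[OF assms(1) less] by simp
next
  case equal
  show ?thesis unfolding equal by (simp only: sum_power_card_minus_1 if_True simp_thms)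
next
  case greater
  define l where "l = k - (CARD('a) - 1)"
  have l: "0 < l" "l < CARD('a) - 1" using greater assms(2) by (auto simp: l_def)
  have k: "k = (l - 1) + CARD('a)" using greater l by (simp add: l_def)
  have "x ^ k = x ^ l" for x :: 'a
  proof -
    have "x ^ k = x ^ (l - 1) * x" by (simp add: k power_add power_card_eq_self)
    also have "\<dots> = x ^ l" using l(1) by (metis Suc_pred' power_Suc2)
    finally show ?thesis .
  qed
  then show ?thesis using sum_power_eq_0[OF l] greater by simp
qed

section \<open>Characteristic three: Frobenius, trace and the Artin-Schreier map\<close>

locale ternary_field =
  fixes n :: nat and ty :: "'a::{field, finite} itself"
  assumes card: "CARD('a) = 3 ^ n" and n_pos: "0 < n"
begin

lemma three_eq_0: "(3::'a) = 0"
proof -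
  have "(3::'a) ^ n = of_nat CARD('a)" by (simp add: card)
  then show ?thesis by (metis of_nat_card_eq_0 power_not_zero)
qed

lemma cube_add: "((x::'a) + y) ^ 3 = x ^ 3 + y ^ 3"
proof -
  have "(x + y) ^ 3 = x ^ 3 + y ^ 3 + 3 * (x ^ 2 * y + x * y ^ 2)" by algebra
  then show ?thesis by (simp add: three_eq_0)
qed

lemma cube_diff: "((x::'a) - y) ^ 3 = x ^ 3 - y ^ 3"
  using cube_add[of "x - y" y] by simp

lemma frobenius_add: "((x::'a) + y) ^ (3 ^ k) = x ^ (3 ^ k) + y ^ (3 ^ k)"
  by (induction k) (simp_all add: power_mult cube_add mult.commute[of 3])

text \<open>The absolute trace from the field with \<open>3 ^ n\<close> elements to its prime
  field.\<close>

definition tr :: "'a \<Rightarrow> 'a" where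
  "tr x = (\<Sum>i<n. x ^ (3 ^ i))"

lemma tr_add: "tr (x + y) = tr x + tr y"
  by (simp add: tr_def frobenius_add sum.distrib)

lemma tr_0 [simp]: "tr 0 = 0"
  by (simp add: tr_def power_0_left)

lemma tr_minus: "tr (- x) = - tr x"
  using tr_add[of x "- x"] by (simp add: eq_neg_iff_add_eq_0 add.commute)

lemma tr_diff: "tr (x - y) = tr x - tr y"
  using tr_add[of x "- y"] by (simp add: tr_minus)

text \<open>Cubing shifts the conjugates cyclically; the last one returns to \<open>x\<close>
  because \<open>x ^ CARD('a) = x\<close>.\<close>

lemma tr_cube: "tr (x ^ 3) = tr x"
proof -
  have "tr (x ^ 3) + x = (\<Sum>i<n. x ^ (3 ^ Suc i)) + x ^ (3 ^ 0)"
    by (simp add: tr_def power_mult)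
  also have "\<dots> = (\<Sum>i<Suc n. x ^ (3 ^ i))" by (simp add: sum.lessThan_Suc_shift del: sum.lessThan_Suc)
  also have "\<dots> = tr x + x" by (simp add: tr_def power_card_eq_self flip: card)
  finally show ?thesis by simp
qed

text \<open>Cubing is additive, so it can be moved inside the trace. With
  \<open>cube_eq_self_iff\<close> this puts every trace in the prime field.\<close>

lemma cube_tr: "(tr x) ^ 3 = tr x"
proof -
  have "(\<Sum>i\<in>A. f i) ^ 3 = (\<Sum>i\<in>A. f i ^ 3)" if "finite A" for A :: "nat set" and f :: "nat \<Rightarrow> 'a"
    using that by (induction A rule: finite_induct) (simp_all add: cube_add)
  then have "(tr x) ^ 3 = (\<Sum>i<n. (x ^ (3 ^ i)) ^ 3)" by (simp add: tr_def)
  also have "\<dots> = tr (x ^ 3)" by (simp add: tr_def mult.commute flip: power_mult)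
  finally show ?thesis by (simp add: tr_cube)
qed

lemma cube_eq_self_iff: "(t::'a) ^ 3 = t \<longleftrightarrow> t = 0 \<or> t = 1 \<or> t = -1"
proof -
  have "t ^ 3 - t = t * ((t - 1) * (t + 1))" by algebra
  then show ?thesis
    by (metis eq_iff_diff_eq_0 eq_neg_iff_add_eq_0 mult_eq_0_iff)
qed

text \<open>The trace is a polynomial function of degree at most \<open>3 ^ (n - 1)\<close>. The
  summand \<open>i = 0\<close> alone contributes to the linear coefficient, so the polynomial is
  nonzero.\<close>

lemma card_tr_0_le: "card {v. tr v = 0} \<le> 3 ^ (n - 1)"
proof -
  define p :: "'a poly" where "p = (\<Sum>i<n. monom 1 (3 ^ i))"
  have poly_p: "poly p x = tr x" for x
    by (simp add: p_def tr_def poly_sum poly_monom)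
  have "coeff p 1 = (\<Sum>i<n. if i = 0 then 1 else 0)"
    unfolding p_def coeff_sum by (rule sum.cong) auto
  then have "p \<noteq> 0" using n_pos by auto
  moreover have "degree p \<le> 3 ^ (n - 1)"
    unfolding p_def
  proof (rule degree_sum_le)
    fix i assume "i \<in> {..<n}"
    then have "(3::nat) ^ i \<le> 3 ^ (n - 1)" by (intro power_increasing) auto
    then show "degree (monom (1::'a) (3 ^ i)) \<le> 3 ^ (n - 1)"
      using degree_monom_le order_trans by blast
  qed simp
  ultimately show ?thesis using card_poly_roots_bound[of p] by (simp add: poly_p)
qed

lemma artin_schreier_fiber: "{z::'a. z ^ 3 - z = w ^ 3 - w} = {w, w + 1, w - 1}"
proof -
  have "z ^ 3 - z = w ^ 3 - w \<longleftrightarrow> (z - w) ^ 3 = z - w" for z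
    unfolding cube_diff by algebra
  then have "z ^ 3 - z = w ^ 3 - w \<longleftrightarrow> z - w = 0 \<or> z - w = 1 \<or> z - w = -1" for z
    unfolding cube_eq_self_iff .
  moreover have "z - w = 1 \<longleftrightarrow> z = w + 1" "z - w = -1 \<longleftrightarrow> z = w - 1" for z
    by (auto simp: diff_eq_eq add.commute)
  ultimately show ?thesis by auto
qed

lemma one_neq_minus_one: "(1::'a) \<noteq> -1"
proof
  assume "(1::'a) = -1"
  then have "(1::'a) + 1 = 0" by (simp only: eq_neg_iff_add_eq_0)
  moreover have "(1::'a) + 1 + 1 = 3" by simp
  ultimately show False using three_eq_0 by simp
qed

lemma card_artin_schreier_fiber: "card {w, w + 1, w - (1::'a)} = 3"
proof -
  have "w + 1 \<noteq> w + (-1)" unfolding add_left_cancel by (rule one_neq_minus_one)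
  then show ?thesis by simp
qed

lemma sum_over_fibers:
  fixes F :: "'a \<Rightarrow> 'a \<Rightarrow> 'b::comm_monoid_add"
  shows "(\<Sum>z\<in>UNIV. F z (z ^ 3 - z))
    = (\<Sum>v\<in>range (\<lambda>z. z ^ 3 - z). \<Sum>z\<in>{z. z ^ 3 - z = v}. F z v)"
proof -
  have "(\<Sum>z\<in>UNIV. F z (z ^ 3 - z))
      = (\<Sum>v\<in>range (\<lambda>z. z ^ 3 - z). \<Sum>z | z \<in> UNIV \<and> z ^ 3 - z = v. F z (z ^ 3 - z))"
    by (rule sum.image_gen) simp
  also have "\<dots> = (\<Sum>v\<in>range (\<lambda>z. z ^ 3 - z). \<Sum>z\<in>{z. z ^ 3 - z = v}. F z v)"
    by (intro sum.cong refl) auto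
  finally show ?thesis .
qed

text \<open>The additive form of Hilbert 90, proved by counting: fibres are cosets of the prime
  field and have three elements, so the range has \<open>3 ^ (n - 1)\<close> elements, at least as
  many as the kernel of the trace that contains it.\<close>

lemma range_artin_schreier: "range (\<lambda>z::'a. z ^ 3 - z) = {v. tr v = 0}"
proof (rule card_seteq)
  show "range (\<lambda>z::'a. z ^ 3 - z) \<subseteq> {v. tr v = 0}"
    by (auto simp: tr_diff tr_cube)
  have "(3::nat) ^ n = (\<Sum>z\<in>(UNIV::'a set). 1)" by (simp add: card)
  also have "\<dots> = (\<Sum>v\<in>range (\<lambda>z::'a. z ^ 3 - z). \<Sum>z\<in>{z. z ^ 3 - z = v}. 1)"
    by (rule sum_over_fibers)
  also have "\<dots> = (\<Sum>v\<in>range (\<lambda>z::'a. z ^ 3 - z). 3)"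
  proof (rule sum.cong)
    fix v :: 'a assume "v \<in> range (\<lambda>z. z ^ 3 - z)"
    then obtain w where v: "v = w ^ 3 - w" by blast
    have "card {z. z ^ 3 - z = v} = 3"
      unfolding v artin_schreier_fiber by (rule card_artin_schreier_fiber)
    then show "(\<Sum>z\<in>{z. z ^ 3 - z = v}. 1) = (3::nat)" by simp
  qed simp
  finally have "3 ^ (n - 1) = card (range (\<lambda>z::'a. z ^ 3 - z))"
    using n_pos power_Suc[of "3::nat" "n - 1"] by simp
  then show "card {v::'a. tr v = 0} \<le> card (range (\<lambda>z::'a. z ^ 3 - z))"
    using card_tr_0_le by simp
qed (rule finite)

end

section \<open>Sums of inverse powers over the elements of trace one\<close>

context ternary_field
begin

lemma power_3_bounds:
  assumes "i < n" "j < n" "3 \<le> n"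
  shows "(3::nat) ^ i + 3 ^ j < 3 ^ n - 1"
proof -
  have "(3::nat) ^ i \<le> 3 ^ (n - 1)" "(3::nat) ^ j \<le> 3 ^ (n - 1)"
    using assms by (auto intro!: power_increasing)
  moreover have "(3::nat) ^ n = 3 * 3 ^ (n - 1)"
    using n_pos power_Suc[of "3::nat" "n - 1"] by simp
  moreover have "(3::nat) ^ 2 \<le> 3 ^ (n - 1)"
    using assms(3) by (intro power_increasing) auto
  then have "9 \<le> (3::nat) ^ (n - 1)" by simp
  ultimately show ?thesis by linarith
qed

text \<open>
  The indicator function of trace one is \<open>- tr\<^sup>2 - tr\<close>, because traces lie in the prime field.
\<close>

lemma sum_inverse_power_tr_one:
  assumes n3: "3 \<le> n" and m: "0 < m" "m < 3 ^ n - 1"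
  shows "(\<Sum>u | tr u = 1. inverse u ^ m) =
    (\<Sum>i<n. if 3 ^ i = m then 1 else 0) + (\<Sum>i<n. \<Sum>j<n. if 3 ^ i + 3 ^ j = m then 1 else 0)"
proof -
  \<comment> \<open>For nonzero \<open>u\<close> the power \<open>u ^ k\<close> is the inverse of
    \<open>u ^ m\<close>, since \<open>u ^ (CARD('a) - 1) = 1\<close>. At \<open>u = 0\<close> the
    factors \<open>tr u\<close> make both sides vanish.\<close>
  define k where "k = (3::nat) ^ n - 1 - m"
  have indicator: "(if tr u = 1 then inverse u ^ m else 0) = - (tr u * u ^ k + tr u ^ 2 * u ^ k)" for u
  proof (cases "u = 0")
    case True
    then show ?thesis using m(1) by simp
  next
    case False
    have "u ^ (k + m) = 1"
      using power_card_minus_1[OF False] m(2) by (simp add: card k_def)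
    then have "inverse u ^ m = u ^ k"
      using False by (simp add: power_add field_simps)
    moreover have "- (1 + 1) = (1::'a)"
      using three_eq_0 by (simp add: neg_eq_iff_add_eq_0)
    moreover have "tr u = 0 \<or> tr u = 1 \<or> tr u = -1"
      using cube_tr[of u] by (simp add: cube_eq_self_iff)
    ultimately show ?thesis
      using one_neq_minus_one by (auto simp: algebra_simps)
  qed
  \<comment> \<open>The exponent \<open>l + k\<close> is below twice \<open>CARD('a) - 1\<close> and
    equals \<open>CARD('a) - 1\<close> exactly when \<open>l = m\<close>.\<close>
  have pow: "(\<Sum>u\<in>UNIV. (u::'a) ^ (l + k)) = (if l = m then -1 else 0)"
    if "0 < l" "l < 3 ^ n - 1" for l
    using sum_power_less[where 'a = 'a, of "l + k"] that m by (auto simp: card k_def)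
  have pow_i: "0 < (3::nat) ^ i \<and> (3::nat) ^ i < 3 ^ n - 1" if "i < n" for i
    using power_3_bounds[OF that that n3] by simp
  have "(\<Sum>u\<in>UNIV. tr u * u ^ k) = (\<Sum>i<n. \<Sum>u\<in>UNIV. u ^ (3 ^ i + k))"
    unfolding tr_def sum_distrib_right power_add by (rule sum.swap)
  also have "\<dots> = - (\<Sum>i<n. if 3 ^ i = m then 1 else 0)"
    unfolding sum_negf[symmetric] by (rule sum.cong) (use pow pow_i in auto)
  finally have 1: "(\<Sum>u\<in>UNIV. tr u * u ^ k) = - (\<Sum>i<n. if 3 ^ i = m then 1 else 0)" .
  have "tr u ^ 2 * u ^ k = (\<Sum>i<n. \<Sum>j<n. u ^ (3 ^ i + 3 ^ j + k))" for u
    unfolding tr_def power2_eq_square sum_product unfolding sum_distrib_right power_add ..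
  then have "(\<Sum>u\<in>UNIV. tr u ^ 2 * u ^ k) = (\<Sum>i<n. \<Sum>u\<in>UNIV. \<Sum>j<n. u ^ (3 ^ i + 3 ^ j + k))"
    by (simp only:) (rule sum.swap)
  also have "\<dots> = (\<Sum>i<n. \<Sum>j<n. \<Sum>u\<in>UNIV. u ^ (3 ^ i + 3 ^ j + k))"
    by (intro sum.cong refl sum.swap)
  also have "\<dots> = - (\<Sum>i<n. \<Sum>j<n. if 3 ^ i + 3 ^ j = m then 1 else 0)"
    unfolding sum_negf[symmetric] by (intro sum.cong refl) (use pow power_3_bounds[OF _ _ n3] in auto)
  finally have 2: "(\<Sum>u\<in>UNIV. tr u ^ 2 * u ^ k) = - (\<Sum>i<n. \<Sum>j<n. if 3 ^ i + 3 ^ j = m then 1 else 0)" .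
  have "(\<Sum>u | tr u = 1. inverse u ^ m) = (\<Sum>u\<in>UNIV. if tr u = 1 then inverse u ^ m else 0)"
    by (simp add: sum.If_cases)
  also have "\<dots> = - ((\<Sum>u\<in>UNIV. tr u * u ^ k) + (\<Sum>u\<in>UNIV. tr u ^ 2 * u ^ k))"
    unfolding indicator sum_negf sum.distrib ..
  finally show ?thesis unfolding 1 2 by simp
qed

text \<open>Powers of three from 9 on exceed \<open>m\<close>, so only 1 and 3 can occur. The value
  therefore no longer depends on \<open>n\<close>, which makes one computation serve all large
  fields.\<close>

lemma sum_inverse_power_tr_one_small:
  assumes n5: "5 \<le> n" and m: "0 < m" "m < 9"
  shows "(\<Sum>u | tr u = 1. inverse u ^ m) =
    (\<Sum>i<2. if 3 ^ i = m then 1 else 0) + (\<Sum>i<2. \<Sum>j<2. if 3 ^ i + 3 ^ j = m then 1 else 0)"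
proof -
  have "(3::nat) ^ 3 \<le> 3 ^ n" using n5 by (intro power_increasing) auto
  then have m': "m < 3 ^ n - 1" using m(2) by simp
  have big: "m < 3 ^ i" if "\<not> i < 2" for i
  proof -
    have "(3::nat) ^ 2 \<le> 3 ^ i" using that by (intro power_increasing) auto
    then show ?thesis using m(2) by simp
  qed
  have restrict: "(\<Sum>i<n. F i) = (\<Sum>i<2. F i)" if "\<And>i. m < 3 ^ i \<Longrightarrow> F i = 0" for F :: "nat \<Rightarrow> 'a"
    by (rule sum.mono_neutral_right) (use n5 that big in auto)
  have "(\<Sum>i<n. \<Sum>j<n. if 3 ^ i + 3 ^ j = m then 1 else 0)
      = (\<Sum>i<2. \<Sum>j<n. if 3 ^ i + 3 ^ j = m then 1 else (0::'a))"
    by (rule restrict) (auto intro!: sum.neutral)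
  also have "\<dots> = (\<Sum>i<2. \<Sum>j<2. if 3 ^ i + 3 ^ j = m then 1 else 0)"
    by (intro sum.cong refl restrict) auto
  finally show ?thesis
    using n5 m m' by (simp add: sum_inverse_power_tr_one restrict)
qed

end

section \<open>Sums over an Artin-Schreier denominator\<close>

locale trace_one = ternary_field n ty
  for n :: nat and ty :: "'a::{field, finite} itself" +
  fixes g :: 'a
  assumes tr_g: "tr g = 1" and n_ge: "5 \<le> n"
begin

definition D :: "'a \<Rightarrow> 'a" where "D z = z ^ 3 - z - g"

text \<open>Values of the Artin-Schreier map have trace zero, whereas \<open>g\<close> has trace
  one.\<close>

lemma D_neq_0: "D z \<noteq> 0"
proof
  assume "D z = 0"
  then have "tr (z ^ 3 - z) = tr g" by (simp add: D_def)
  then show False by (simp add: tr_diff tr_cube tr_g)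
qed

lemma g_neq_0: "g \<noteq> 0"
  using tr_g by auto

lemma D_shift: "D (z + 1) = D z" "D (z - 1) = D z"
  by (simp_all add: D_def cube_add cube_diff)

lemma sum_shift:
  fixes F :: "'a \<Rightarrow> 'a"
  shows "(\<Sum>z\<in>UNIV. F (z + 1)) = (\<Sum>z\<in>UNIV. F z)" "(\<Sum>z\<in>UNIV. F (z - 1)) = (\<Sum>z\<in>UNIV. F z)"
  by (rule sum.reindex_bij_witness[of _ "\<lambda>x. x - 1" "\<lambda>x. x + 1"]; simp)
     (rule sum.reindex_bij_witness[of _ "\<lambda>x. x + 1" "\<lambda>x. x - 1"]; simp)

lemma two_eq_minus_one: "(2::'a) = -1"
  using three_eq_0 by (simp add: eq_neg_iff_add_eq_0)

text \<open>\<open>D\<close> is invariant under shifts by the prime field. Shifting \<open>z\<close>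
  by 1 and by -1 in the sum of \<open>z ^ 2 * F (D z)\<close> yields two linear equations for the
  moments of degree 0 and 1; their determinant is nonzero in characteristic three.\<close>

lemma sum_D:
  fixes F :: "'a \<Rightarrow> 'a"
  shows "(\<Sum>z\<in>UNIV. F (D z)) = 0" "(\<Sum>z\<in>UNIV. z * F (D z)) = 0"
proof -
  let ?S0 = "\<Sum>z\<in>UNIV. F (D z)" and ?S1 = "\<Sum>z\<in>UNIV. z * F (D z)"
    and ?S2 = "\<Sum>z\<in>UNIV. z ^ 2 * F (D z)"
  have "?S2 = (\<Sum>z\<in>UNIV. (z + 1) ^ 2 * F (D (z + 1)))"
    by (rule sum_shift(1)[symmetric])
  also have "\<dots> = ?S2 + (2 * ?S1 + ?S0)"
    unfolding D_shift sum_distrib_left sum.distrib[symmetric]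
    by (rule sum.cong) (simp_all add: power2_eq_square algebra_simps)
  finally have 1: "2 * ?S1 + ?S0 = 0" by simp
  have "?S2 = (\<Sum>z\<in>UNIV. (z - 1) ^ 2 * F (D (z - 1)))"
    by (rule sum_shift(2)[symmetric])
  also have "\<dots> = ?S2 + (?S0 - 2 * ?S1)"
    unfolding D_shift sum_distrib_left sum.distrib[symmetric] sum_subtractf[symmetric]
    by (rule sum.cong) (simp_all add: power2_eq_square algebra_simps)
  finally have 2: "?S0 - 2 * ?S1 = 0" by simp
  from 1 2 have "2 * ?S0 = 0" by algebra
  then show "?S0 = 0" by (simp add: two_eq_minus_one)
  with 1 show "?S1 = 0" by (simp add: two_eq_minus_one)
qed

text \<open>On a fibre \<open>{w, w + 1, w - 1}\<close> the squares add up to 2 = -1. What remains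
  is a sum over the values \<open>v - g\<close> with \<open>tr v = 0\<close>, which are the
  negatives of the elements of trace one.\<close>

lemma sum_square_D:
  fixes F :: "'a \<Rightarrow> 'a"
  shows "(\<Sum>z\<in>UNIV. z ^ 2 * F (D z)) = - (\<Sum>u | tr u = 1. F (- u))"
proof -
  have inner: "(\<Sum>z\<in>{z. z ^ 3 - z = v}. z ^ 2 * F (v - g)) = - F (v - g)"
    if v: "v \<in> range (\<lambda>z. z ^ 3 - z)" for v
  proof -
    from v obtain w where w: "v = w ^ 3 - w" by blast
    have "w + 1 \<noteq> w + (-1)" unfolding add_left_cancel by (rule one_neq_minus_one)
    then have "(\<Sum>z\<in>{w, w + 1, w - 1}. z ^ 2) = w ^ 2 + (w + 1) ^ 2 + (w - 1) ^ 2"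
      by (simp add: add.assoc)
    also have "\<dots> = 3 * (w ^ 2 + 1) - 1" by algebra
    finally have "(\<Sum>z\<in>{z. z ^ 3 - z = v}. z ^ 2) = -1"
      unfolding w artin_schreier_fiber by (simp add: three_eq_0)
    then show ?thesis by (simp flip: sum_distrib_right)
  qed
  have "(\<Sum>z\<in>UNIV. z ^ 2 * F (D z)) = (\<Sum>v\<in>range (\<lambda>z. z ^ 3 - z). \<Sum>z\<in>{z. z ^ 3 - z = v}. z ^ 2 * F (v - g))"
    unfolding D_def by (rule sum_over_fibers[where F = "\<lambda>z v. z ^ 2 * F (v - g)"])
  also have "\<dots> = (\<Sum>v | tr v = 0. - F (v - g))"
    unfolding range_artin_schreier[symmetric] by (rule sum.cong[OF refl inner])
  also have "\<dots> = (\<Sum>u | tr u = 1. - F (- u))"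
    by (rule sum.reindex_bij_witness[of _ "\<lambda>u. g - u" "\<lambda>v. g - v"]) (auto simp: tr_diff tr_g)
  finally show ?thesis by (simp add: sum_negf)
qed

text \<open>The exponent of \<open>z\<close> is an integer because the substitution
  \<open>x = g / z\<close> creates negative powers; this is why \<open>z = 0\<close> is left
  out.\<close>

definition T :: "int \<Rightarrow> nat \<Rightarrow> 'a" where
  "T j m = (\<Sum>z\<in>UNIV - {0}. z powi j * inverse (D z) ^ m)"

text \<open>This is \<open>z ^ 3 = z + g + D z\<close>, multiplied by
  \<open>z powi j / D z ^ Suc m\<close> and summed. Since \<open>g\<close> is nonzero, it can be run
  both upwards and downwards in \<open>j\<close>.\<close>

lemma T_Suc: "T (j + 3) (Suc m) = T (j + 1) (Suc m) + g * T j (Suc m) + T j m"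
  unfolding T_def sum_distrib_left sum.distrib[symmetric]
proof (rule sum.cong)
  fix z :: 'a assume "z \<in> UNIV - {0}"
  then have z: "z \<noteq> 0" by simp
  define d where "d = inverse (D z)"
  have d: "(z ^ 3 - z - g) * d = 1" using D_neq_0[of z] by (simp add: d_def D_def)
  have j: "z powi (j + 3) = z powi j * z ^ 3" "z powi (j + 1) = z powi j * z"
    using z by (simp_all add: power_int_add)
  have "z powi j * z ^ 3 * (d * d ^ m) = z powi j * z * (d * d ^ m) + g * (z powi j * (d * d ^ m)) + z powi j * d ^ m"
      proof -
    have "z ^ 3 * d = z * d + g * d + 1" using d by (simp add: algebra_simps)
    then have "z powi j * d ^ m * (z ^ 3 * d) = z powi j * d ^ m * (z * d + g * d + 1)" by simp
    then show ?thesis by (simp add: algebra_simps)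
  qed
  then show "z powi (j + 3) * inverse (D z) ^ Suc m =
      z powi (j + 1) * inverse (D z) ^ Suc m + g * (z powi j * inverse (D z) ^ Suc m) + z powi j * inverse (D z) ^ m"
    unfolding j d_def[symmetric] by simp
qed simp

lemma T_nat:
  assumes "0 < j"
  shows "T (int j) m = (\<Sum>z\<in>UNIV. z ^ j * inverse (D z) ^ m)"
  unfolding T_def power_int_of_nat by (rule sum.mono_neutral_left) (use assms in auto)

lemma T_1: "T 1 m = 0"
  using T_nat[of 1 m] sum_D(2)[of "\<lambda>x. inverse x ^ m"] by simp

lemma T_2: "T 2 m = - ((-1) ^ m * (\<Sum>u | tr u = 1. inverse u ^ m))"
proof -
  have "T 2 m = - (\<Sum>u | tr u = 1. inverse (- u) ^ m)"
    using T_nat[of 2 m] sum_square_D[of "\<lambda>x. inverse x ^ m"] by simp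
  also have "(\<Sum>u | tr u = 1. inverse (- u) ^ m) = (-1) ^ m * (\<Sum>u | tr u = 1. inverse u ^ m)"
    unfolding sum_distrib_left inverse_minus_eq using power_minus by (intro sum.cong refl)
  finally show ?thesis .
qed

text \<open>By \<open>sum_D\<close> the sum over all \<open>z\<close> vanishes, so
  \<open>T 0 m\<close> is the negative of the missing term at \<open>z = 0\<close>, where
  \<open>D 0 = - g\<close>.\<close>

lemma T_0: "g ^ m * T 0 m = - ((-1) ^ m)"
proof -
  have "0 = (\<Sum>z\<in>UNIV. inverse (D z) ^ m)"
    using sum_D(1)[of "\<lambda>x. inverse x ^ m"] by simp
  also have "\<dots> = inverse (D 0) ^ m + T 0 m"
    unfolding T_def by (subst sum.remove[of _ 0]) auto
  finally have "T 0 m = - (inverse (- g) ^ m)"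
    by (simp add: D_def eq_neg_iff_add_eq_0 add.commute)
  also have "\<dots> = - ((-1) ^ m * inverse g ^ m)"
    using power_minus[of "inverse g" m] by simp
  finally have T: "T 0 m = - ((-1) ^ m * inverse g ^ m)" .
  have "g ^ m * inverse g ^ m = 1"
    unfolding power_mult_distrib[symmetric] using g_neq_0 by simp
  then show ?thesis unfolding T by (simp add: mult.left_commute)
qed

text \<open>For \<open>m = 0\<close>, where the recursion ends, there is no denominator and
  \<open>T\<close> is an ordinary power sum; inversion of the nonzero elements reduces negative
  exponents to positive ones.\<close>

lemma T_base:
  assumes "0 < k" "k < 3 ^ n - 1"
  shows "T (int k) 0 = 0" "T (- int k) 0 = 0"
proof -
  have pow: "(\<Sum>z\<in>UNIV. (z::'a) ^ k) = 0"
    by (rule sum_power_eq_0) (use assms card in simp_all)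
  then show "T (int k) 0 = 0"
    using T_nat[OF assms(1), of 0] by simp
  have "T (- int k) 0 = (\<Sum>z\<in>UNIV - {0}. inverse z ^ k)"
    unfolding T_def by (simp add: power_int_minus power_inverse)
  also have "\<dots> = (\<Sum>z\<in>UNIV - {0}. z ^ k)"
    by (rule sum.reindex_bij_witness[of _ inverse inverse]) auto
  also have "\<dots> = (\<Sum>z\<in>UNIV. z ^ k)"
    by (rule sum.mono_neutral_left) (use assms(1) in auto)
  finally show "T (- int k) 0 = 0" unfolding pow .
qed

end

context ternary_field
begin

text \<open>
  Polynomial identities in characteristic three are stated as identities over the integers with an explicit
  multiple of \<open>3\<close>, because \<^verbatim>\<open>algebra\<close> does not compute modulo \<open>3\<close>.
\<close>

lemma eq_mod_3: "x = y + 3 * r \<Longrightarrow> x = (y::'a)"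
  by (simp add: three_eq_0)

end

section \<open>Starting values of the recursion\<close>

context trace_one
begin

text \<open>The ways to write \<open>m\<close> as one or two summands from {1, 3}: 1 and 3
  themselves, 2 = 1 + 1, 6 = 3 + 3, and 4 = 1 + 3 in two orders.\<close>

lemma T_2_small:
  assumes "0 < m" "m < 9"
  shows "T 2 m = - ((-1) ^ m * (of_bool (m = 1) + of_bool (m = 2) + of_bool (m = 3)
    + 2 * of_bool (m = 4) + of_bool (m = 6)))"
  unfolding T_2 sum_inverse_power_tr_one_small[OF n_ge assms]
  by (simp add: numeral_2_eq_2)

lemma T_2_1: "T 2 (Suc 0) = 1" and T_2_2: "T 2 2 = - 1" and T_2_3: "T 2 3 = 1" and T_2_4: "T 2 4 = 1"
  and T_2_5: "T 2 5 = 0" and T_2_6: "T 2 6 = - 1" and T_2_7: "T 2 7 = 0"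
  by (simp_all add: T_2_small two_eq_minus_one)

text \<open>By the recursion at \<open>j = 0\<close> and \<open>T_1\<close>, the value is
  \<open>g * T 0 m + T 0 (m - 1)\<close>, and the closed form \<open>T_0\<close> has alternating
  signs, so the two terms cancel.\<close>

lemma T_3:
  assumes "0 < m"
  shows "T 3 m = 0"
proof -
  have "T 3 m = g * T 0 m + T 0 (m - 1)"
    using T_Suc[of 0 "m - 1"] assms by (simp add: T_1)
  then have "g ^ (m - 1) * T 3 m = g ^ (m - 1) * g * T 0 m + g ^ (m - 1) * T 0 (m - 1)"
    by (simp add: algebra_simps)
  also have "\<dots> = g ^ m * T 0 m + g ^ (m - 1) * T 0 (m - 1)"
    using assms by (simp flip: power_Suc2)
  also have "\<dots> = 0"
    unfolding T_0 using assms by (cases m) simp_all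
  finally show ?thesis using g_neq_0 by simp
qed

lemma T_rec: "0 < m \<Longrightarrow> T (j + 3) m = T (j + 1) m + g * T j m + T j (m - 1)"
  using T_Suc[of j "m - 1"] by simp

lemma T_neg_0:
  "T (-1) 0 = 0" "T (-2) 0 = 0" "T (-3) 0 = 0" "T (-4) 0 = 0" "T (-5) 0 = 0" "T (-6) 0 = 0" "T (-7) 0 = 0"
proof -
  have "(3::nat) ^ 3 \<le> 3 ^ n" using n_ge by (intro power_increasing) auto
  then have "T (- int k) 0 = 0" if "0 < k" "k < 8" for k
    using that by (intro T_base(2)) auto
  from this[of 1] this[of 2] this[of 3] this[of 4] this[of 5] this[of 6] this[of 7]
  show "T (-1) 0 = 0" "T (-2) 0 = 0" "T (-3) 0 = 0" "T (-4) 0 = 0" "T (-5) 0 = 0" "T (-6) 0 = 0" "T (-7) 0 = 0"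
    by simp_all
qed

text \<open>The value \<open>0\<close> at \<open>z = 0\<close> makes \<open>mono\<close> multiplicative without side conditions.\<close>

definition mono :: "int \<Rightarrow> nat \<Rightarrow> 'a \<Rightarrow> 'a" where
  "mono j m z = (if z = 0 then 0 else z powi j * inverse (D z) ^ m)"

lemma mono_mult: "x * mono i l z * (y * mono j m z) = x * y * mono (i + j) (l + m) z"
  by (simp add: mono_def power_int_add power_add)

lemma mono_cube: "mono j m z ^ 3 = mono (3 * j) (3 * m) z"
  by (simp add: mono_def power_mult_distrib power_int_mult power_mult[symmetric] mult.commute power_int_power)

lemma sum_mono: "(\<Sum>z\<in>UNIV - {0}. c * mono j m z) = c * T j m"
  unfolding T_def sum_distrib_left by (rule sum.cong) (auto simp: mono_def)

end

section \<open>Power sums of the values\<close>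

context trace_one
begin

text \<open>With \<open>p = - \<beta>\<close>, \<open>q = \<beta> - a\<close>,
  \<open>r = \<beta> * g\<close> this is the value of \<open>f\<close> at \<open>g / z\<close> minus
  \<open>\<beta>\<close>, once \<open>c = - b * g\<close> is known. The shift by
  \<open>\<beta>\<close> brings the numerator over \<open>D z\<close> down to degree two.\<close>

definition phi :: "'a \<Rightarrow> 'a \<Rightarrow> 'a \<Rightarrow> 'a \<Rightarrow> 'a" where
  "phi p q r z = g / z + (p * z ^ 2 + q * z + r) / D z"

lemma phi_eq_mono:
  assumes "z \<noteq> 0"
  shows "phi p q r z = g * mono (-1) 0 z + p * mono 2 1 z + q * mono 1 1 z + r * mono 0 1 z"
  using assms by (simp add: phi_def mono_def power_int_minus divide_inverse distrib_right)

text \<open>Cubing is additive, so a cube still has only four terms. The exponents 4 = 3 + 1, 5 = 3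
  + 1 + 1 and 7 = 3 + 3 + 1 are therefore expanded as products of two or three four-term
  factors.\<close>

lemma phi_cube:
  assumes "z \<noteq> 0"
  shows "phi p q r z ^ 3 =
    g ^ 3 * mono (-3) 0 z + p ^ 3 * mono 6 3 z + q ^ 3 * mono 3 3 z + r ^ 3 * mono 0 3 z"
  unfolding phi_eq_mono[OF assms] cube_add power_mult_distrib mono_cube by simp

section \<open>Table of the values of \<open>T\<close> occurring in the expansions\<close>

text \<open>
  In the names below, \<open>T_j_m\<close> is about \<open>T j m\<close> and \<open>T_mj_m\<close> about \<open>T (- j) m\<close>. A power of \<open>g\<close> clears the
  denominator of the value.
\<close>

lemma T_0_1: "g * T 0 (Suc 0) = 1"
  using T_0[of 1] by simp

text \<open>Negative exponents: the recursion is solved for its term \<open>g * T j m\<close>,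
  moving downwards in \<open>j\<close>.\<close>

lemma T_m1_1: "g ^ 2 * T (-1) (Suc 0) = - 1 + g"
  using T_rec[of "Suc 0" "-1", simplified] T_2_1 T_0_1 T_neg_0(1) by algebra

lemma T_m2_1: "g ^ 3 * T (-2) (Suc 0) = 1 - g"
  using T_rec[of "Suc 0" "-2", simplified] T_1[of "Suc 0"] T_m1_1 T_neg_0(2) by algebra

lemma T_m3_1: "g ^ 4 * T (-3) (Suc 0) = - 1 + g + g ^ 2"
  using T_rec[of "Suc 0" "-3", simplified] T_0_1 T_m2_1 T_neg_0(3) by algebra

lemma T_m4_1: "g ^ 5 * T (-4) (Suc 0) = 1 - g + g ^ 2 + g ^ 3"
  by (rule eq_mod_3[where r = "- (g ^ 2)"])
    (use T_rec[of "Suc 0" "-4", simplified] T_m1_1 T_m3_1 T_neg_0(4) in algebra)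

lemma T_m5_1: "g ^ 6 * T (-5) (Suc 0) = - 1 + g + g ^ 3"
  by (rule eq_mod_3[where r = "- (g ^ 3)"])
    (use T_rec[of "Suc 0" "-5", simplified] T_m2_1 T_m4_1 T_neg_0(5) in algebra)

lemma T_m6_1: "g ^ 7 * T (-6) (Suc 0) = 1 - g - g ^ 2 + g ^ 4"
  using T_rec[of "Suc 0" "-6", simplified] T_m3_1 T_m5_1 T_neg_0(6) by algebra

lemma T_0_2: "g ^ 2 * T 0 2 = - 1"
  using T_0[of 2] by simp

text \<open>Exponents from 4 on: the recursion is read upwards, from \<open>T_1\<close>,
  \<open>T_3\<close> and the values at exponent 2.\<close>

lemma T_4_2: "T 4 2 = - 1"
  using T_rec[of 2 1, simplified] T_2_2 T_1[of 2] T_1[of "Suc 0"] by algebra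

lemma T_m1_2: "g ^ 3 * T (-1) 2 = - 1 - g - g ^ 2"
  by (rule eq_mod_3[where r = "1"])
    (use T_rec[of 2 "-1", simplified] T_2_2 T_0_2 T_m1_1 in algebra)

lemma T_m2_2: "g ^ 3 * T (-2) 2 = - 1 + g"
  by (rule eq_mod_3[where r = "1"])
    (use T_rec[of 2 "-2", simplified] T_1[of 2] T_m1_2 T_m2_1 in algebra)

lemma T_m3_2: "g ^ 5 * T (-3) 2 = 1"
  by (rule eq_mod_3[where r = "- (g ^ 2)"])
    (use T_rec[of 2 "-3", simplified] T_0_2 T_m2_2 T_m3_1 in algebra)

lemma T_4_3: "T 4 3 = 1"
  using T_rec[of 3 1, simplified] T_2_3 T_1[of 3] T_1[of 2] by algebra

lemma T_0_3: "g ^ 3 * T 0 3 = 1"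
  using T_0[of 3] by simp

lemma T_m1_3: "g ^ 3 * T (-1) 3 = 1 + g + g ^ 2"
  using T_rec[of 3 "-1", simplified] T_2_3 T_0_3 T_m1_2 by algebra

lemma T_5_3: "T 5 3 = - 1 + g"
  using T_rec[of 3 2, simplified] T_3[of 3, simplified] T_2_3 T_2_2 by algebra

lemma T_m2_3: "g ^ 3 * T (-2) 3 = 1 - g"
  by (rule eq_mod_3[where r = "- 1"])
    (use T_rec[of 3 "-2", simplified] T_1[of 3] T_m1_3 T_m2_2 in algebra)

lemma T_m3_3: "g ^ 6 * T (-3) 3 = - 1 + g ^ 3"
  using T_rec[of 3 "-3", simplified] T_0_3 T_m2_3 T_m3_2 by algebra

lemma T_m4_2: "g ^ 6 * T (-4) 2 = 1 + g + g ^ 2 + g ^ 3 - g ^ 4"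
  by (rule eq_mod_3[where r = "- 1 - g ^ 2 - g ^ 3"])
    (use T_rec[of 2 "-4", simplified] T_m1_2 T_m3_2 T_m4_1 in algebra)

lemma T_m4_3: "g ^ 6 * T (-4) 3 = - 1 - g - g ^ 2 - g ^ 3 + g ^ 4"
  by (rule eq_mod_3[where r = "g ^ 3"])
    (use T_rec[of 3 "-4", simplified] T_m1_3 T_m3_3 T_m4_2 in algebra)

lemma T_0_4: "g ^ 4 * T 0 4 = - 1"
  using T_0[of 4] by simp

lemma T_m1_4: "g ^ 5 * T (-1) 4 = 1 - g - g ^ 2 - g ^ 3 + g ^ 4"
  using T_rec[of 4 "-1", simplified] T_2_4 T_0_4 T_m1_3 by algebra

lemma T_4_4: "T 4 4 = 1"
  using T_rec[of 4 1, simplified] T_2_4 T_1[of 4] T_1[of 3] by algebra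

lemma T_5_4: "T 5 4 = 1 + g"
  using T_rec[of 4 2, simplified] T_3[of 4, simplified] T_2_4 T_2_3 by algebra

lemma T_m2_4: "g ^ 6 * T (-2) 4 = - 1 + g - g ^ 3 - g ^ 4"
  by (rule eq_mod_3[where r = "g ^ 3"])
    (use T_rec[of 4 "-2", simplified] T_1[of 4] T_m1_4 T_m2_3 in algebra)

lemma T_6_4: "T 6 4 = 1"
  using T_rec[of 4 3, simplified] T_4_4 T_3[of 4, simplified] T_3[of 3, simplified] by algebra

lemma T_m3_4: "g ^ 7 * T (-3) 4 = - 1 - g - g ^ 2 + g ^ 4"
  by (rule eq_mod_3[where r = "1"])
    (use T_rec[of 4 "-3", simplified] T_0_4 T_m2_4 T_m3_3 in algebra)

lemma T_7_4: "T 7 4 = - 1 - g"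
  by (rule eq_mod_3[where r = "1 + g"])
    (use T_rec[of 4 4, simplified] T_5_4 T_4_4 T_4_3 in algebra)

lemma T_8_4: "T 8 4 = - g + g ^ 2"
  by (rule eq_mod_3[where r = "g"])
    (use T_rec[of 4 5, simplified] T_6_4 T_5_4 T_5_3 in algebra)

lemma T_0_5: "g ^ 5 * T 0 5 = 1"
  using T_0[of 5] by simp

lemma T_4_5: "T 4 5 = 0"
  using T_rec[of 5 1, simplified] T_2_5 T_1[of 5] T_1[of 4] by algebra

lemma T_5_5: "T 5 5 = 1"
  using T_rec[of 5 2, simplified] T_3[of 5, simplified] T_2_5 T_2_4 by algebra

lemma T_6_5: "T 6 5 = 0"
  using T_rec[of 5 3, simplified] T_4_5 T_3[of 5, simplified] T_3[of 4, simplified] by algebra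

lemma T_7_5: "T 7 5 = - 1"
  by (rule eq_mod_3[where r = "1"])
    (use T_rec[of 5 4, simplified] T_5_5 T_4_5 T_4_4 in algebra)

lemma T_8_5: "T 8 5 = 1 - g"
  by (rule eq_mod_3[where r = "g"])
    (use T_rec[of 5 5, simplified] T_6_5 T_5_5 T_5_4 in algebra)

lemma T_9_5: "T 9 5 = 0"
  using T_rec[of 5 6, simplified] T_7_5 T_6_5 T_6_4 by algebra

lemma T_10_5: "T 10 5 = 0"
  by (rule eq_mod_3[where r = "- g"])
    (use T_rec[of 5 7, simplified] T_8_5 T_7_5 T_7_4 in algebra)

lemma T_0_6: "g ^ 6 * T 0 6 = - 1"
  using T_0[of 6] by simp

lemma T_m1_5: "g ^ 6 * T (-1) 5 = 1 + g + g ^ 2 + g ^ 3 - g ^ 4"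
  by (rule eq_mod_3[where r = "- 1"])
    (use T_rec[of 5 "-1", simplified] T_2_5 T_0_5 T_m1_4 in algebra)

lemma T_m1_6: "g ^ 6 * T (-1) 6 = - 1 - g - g ^ 2 + g ^ 3 - g ^ 5"
  using T_rec[of 6 "-1", simplified] T_2_6 T_0_6 T_m1_5 by algebra

lemma T_5_6: "T 5 6 = - g"
  using T_rec[of 6 2, simplified] T_3[of 6, simplified] T_2_6 T_2_5 by algebra

lemma T_4_6: "T 4 6 = - 1"
  using T_rec[of 6 1, simplified] T_2_6 T_1[of 6] T_1[of 5] by algebra

lemma T_6_6: "T 6 6 = - 1"
  using T_rec[of 6 3, simplified] T_4_6 T_3[of 6, simplified] T_3[of 5, simplified] by algebra

lemma T_8_6: "T 8 6 = - (g ^ 2)"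
  using T_rec[of 6 5, simplified] T_6_6 T_5_6 T_5_5 by algebra

lemma T_7_6: "T 7 6 = g"
  by (rule eq_mod_3[where r = "- g"])
    (use T_rec[of 6 4, simplified] T_5_6 T_4_6 T_4_5 in algebra)

lemma T_9_6: "T 9 6 = 0"
  using T_rec[of 6 6, simplified] T_7_6 T_6_6 T_6_5 by algebra

lemma T_11_6: "T 11 6 = 1 - g - g ^ 3"
  using T_rec[of 6 8, simplified] T_9_6 T_8_6 T_8_5 by algebra

lemma T_0_7: "g ^ 7 * T 0 7 = 1"
  using T_0[of 7] by simp

lemma T_4_7: "T 4 7 = 0"
  using T_rec[of 7 1, simplified] T_2_7 T_1[of 7] T_1[of 6] by algebra

lemma T_5_7: "T 5 7 = - 1"
  using T_rec[of 7 2, simplified] T_3[of 7, simplified] T_2_7 T_2_6 by algebra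

lemma T_6_7: "T 6 7 = 0"
  using T_rec[of 7 3, simplified] T_4_7 T_3[of 7, simplified] T_3[of 6, simplified] by algebra

lemma T_7_7: "T 7 7 = 1"
  by (rule eq_mod_3[where r = "- 1"])
    (use T_rec[of 7 4, simplified] T_5_7 T_4_7 T_4_6 in algebra)

lemma T_8_7: "T 8 7 = g"
  by (rule eq_mod_3[where r = "- g"])
    (use T_rec[of 7 5, simplified] T_6_7 T_5_7 T_5_6 in algebra)

lemma T_9_7: "T 9 7 = 0"
  using T_rec[of 7 6, simplified] T_7_7 T_6_7 T_6_6 by algebra

lemma T_10_7: "T 10 7 = 0"
  by (rule eq_mod_3[where r = "g"])
    (use T_rec[of 7 7, simplified] T_8_7 T_7_7 T_7_6 in algebra)

lemma T_11_7: "T 11 7 = 0"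
  using T_rec[of 7 8, simplified] T_9_7 T_8_7 T_8_6 by algebra

lemma T_12_7: "T 12 7 = 0"
  using T_rec[of 7 9, simplified] T_10_7 T_9_7 T_9_6 by algebra

lemma T_10_6: "T 10 6 = - 1"
  using T_rec[of 6 7, simplified] T_8_6 T_7_6 T_7_5 by algebra

lemma T_13_7: "T 13 7 = - 1"
  using T_rec[of 7 10, simplified] T_11_7 T_10_7 T_10_6 by algebra

lemma T_14_7: "T 14 7 = 1 - g - g ^ 3"
  using T_rec[of 7 11, simplified] T_12_7 T_11_7 T_11_6 by algebra

section \<open>Expansion of the power sums in terms of \<open>T\<close>\<close>

lemma phi_power_2:
  "(\<Sum>z\<in>UNIV - {0}. phi p q r z ^ 2) = (\<Sum>z\<in>UNIV - {0}.
    (g * mono (-1) 0 z + p * mono 2 1 z + q * mono 1 1 z + r * mono 0 1 z) *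
    (g * mono (-1) 0 z + p * mono 2 1 z + q * mono 1 1 z + r * mono 0 1 z))"
proof (rule sum.cong)
  fix z :: 'a assume "z \<in> UNIV - {0}"
  then have z: "z \<noteq> 0" by simp
  have "phi p q r z ^ 2 = phi p q r z * phi p q r z"
    by (simp add: eval_nat_numeral)
  also have "\<dots> = (g * mono (-1) 0 z + p * mono 2 1 z + q * mono 1 1 z + r * mono 0 1 z) *
    (g * mono (-1) 0 z + p * mono 2 1 z + q * mono 1 1 z + r * mono 0 1 z)"
    unfolding phi_eq_mono[OF z] ..
  finally show "phi p q r z ^ 2 =
    (g * mono (-1) 0 z + p * mono 2 1 z + q * mono 1 1 z + r * mono 0 1 z) *
    (g * mono (-1) 0 z + p * mono 2 1 z + q * mono 1 1 z + r * mono 0 1 z)" .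
qed simp

lemma phi_power_4:
  "(\<Sum>z\<in>UNIV - {0}. phi p q r z ^ 4) = (\<Sum>z\<in>UNIV - {0}.
    (g ^ 3 * mono (-3) 0 z + p ^ 3 * mono 6 3 z + q ^ 3 * mono 3 3 z + r ^ 3 * mono 0 3 z) *
    (g * mono (-1) 0 z + p * mono 2 1 z + q * mono 1 1 z + r * mono 0 1 z))"
proof (rule sum.cong)
  fix z :: 'a assume "z \<in> UNIV - {0}"
  then have z: "z \<noteq> 0" by simp
  have "phi p q r z ^ 4 = phi p q r z ^ 3 * phi p q r z"
    by (simp add: eval_nat_numeral)
  also have "\<dots> = (g ^ 3 * mono (-3) 0 z + p ^ 3 * mono 6 3 z + q ^ 3 * mono 3 3 z + r ^ 3 * mono 0 3 z) *
    (g * mono (-1) 0 z + p * mono 2 1 z + q * mono 1 1 z + r * mono 0 1 z)"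
    unfolding phi_cube[OF z] unfolding phi_eq_mono[OF z] ..
  finally show "phi p q r z ^ 4 =
    (g ^ 3 * mono (-3) 0 z + p ^ 3 * mono 6 3 z + q ^ 3 * mono 3 3 z + r ^ 3 * mono 0 3 z) *
    (g * mono (-1) 0 z + p * mono 2 1 z + q * mono 1 1 z + r * mono 0 1 z)" .
qed simp

lemma phi_power_5:
  "(\<Sum>z\<in>UNIV - {0}. phi p q r z ^ 5) = (\<Sum>z\<in>UNIV - {0}.
    (g ^ 3 * mono (-3) 0 z + p ^ 3 * mono 6 3 z + q ^ 3 * mono 3 3 z + r ^ 3 * mono 0 3 z) *
    (g * mono (-1) 0 z + p * mono 2 1 z + q * mono 1 1 z + r * mono 0 1 z) *
    (g * mono (-1) 0 z + p * mono 2 1 z + q * mono 1 1 z + r * mono 0 1 z))"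
proof (rule sum.cong)
  fix z :: 'a assume "z \<in> UNIV - {0}"
  then have z: "z \<noteq> 0" by simp
  have "phi p q r z ^ 5 = phi p q r z ^ 3 * phi p q r z * phi p q r z"
    by (simp add: eval_nat_numeral)
  also have "\<dots> = (g ^ 3 * mono (-3) 0 z + p ^ 3 * mono 6 3 z + q ^ 3 * mono 3 3 z + r ^ 3 * mono 0 3 z) *
    (g * mono (-1) 0 z + p * mono 2 1 z + q * mono 1 1 z + r * mono 0 1 z) *
    (g * mono (-1) 0 z + p * mono 2 1 z + q * mono 1 1 z + r * mono 0 1 z)"
    unfolding phi_cube[OF z] unfolding phi_eq_mono[OF z] ..
  finally show "phi p q r z ^ 5 =
    (g ^ 3 * mono (-3) 0 z + p ^ 3 * mono 6 3 z + q ^ 3 * mono 3 3 z + r ^ 3 * mono 0 3 z) *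
    (g * mono (-1) 0 z + p * mono 2 1 z + q * mono 1 1 z + r * mono 0 1 z) *
    (g * mono (-1) 0 z + p * mono 2 1 z + q * mono 1 1 z + r * mono 0 1 z)" .
qed simp

lemma phi_power_7:
  "(\<Sum>z\<in>UNIV - {0}. phi p q r z ^ 7) = (\<Sum>z\<in>UNIV - {0}.
    (g ^ 3 * mono (-3) 0 z + p ^ 3 * mono 6 3 z + q ^ 3 * mono 3 3 z + r ^ 3 * mono 0 3 z) *
    (g ^ 3 * mono (-3) 0 z + p ^ 3 * mono 6 3 z + q ^ 3 * mono 3 3 z + r ^ 3 * mono 0 3 z) *
    (g * mono (-1) 0 z + p * mono 2 1 z + q * mono 1 1 z + r * mono 0 1 z))"
proof (rule sum.cong)
  fix z :: 'a assume "z \<in> UNIV - {0}"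
  then have z: "z \<noteq> 0" by simp
  have "phi p q r z ^ 7 = phi p q r z ^ 3 * phi p q r z ^ 3 * phi p q r z"
    by (simp add: eval_nat_numeral)
  also have "\<dots> = (g ^ 3 * mono (-3) 0 z + p ^ 3 * mono 6 3 z + q ^ 3 * mono 3 3 z + r ^ 3 * mono 0 3 z) *
    (g ^ 3 * mono (-3) 0 z + p ^ 3 * mono 6 3 z + q ^ 3 * mono 3 3 z + r ^ 3 * mono 0 3 z) *
    (g * mono (-1) 0 z + p * mono 2 1 z + q * mono 1 1 z + r * mono 0 1 z)"
    unfolding phi_cube[OF z] unfolding phi_eq_mono[OF z] ..
  finally show "phi p q r z ^ 7 =
    (g ^ 3 * mono (-3) 0 z + p ^ 3 * mono 6 3 z + q ^ 3 * mono 3 3 z + r ^ 3 * mono 0 3 z) *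
    (g ^ 3 * mono (-3) 0 z + p ^ 3 * mono 6 3 z + q ^ 3 * mono 3 3 z + r ^ 3 * mono 0 3 z) *
    (g * mono (-1) 0 z + p * mono 2 1 z + q * mono 1 1 z + r * mono 0 1 z)" .
qed simp

text \<open>A product of monomials \<open>mono\<close> adds their exponent pairs, so the expansion
  becomes linear in the sums \<open>T\<close>; terms with equal pairs are collected.\<close>

lemma sum_phi_power_2:
  "(\<Sum>z\<in>UNIV - {0}. phi p q r z ^ 2) =
    g ^ 2 * T (-2) 0 + 2 * r * g * T (-1) (Suc 0) + 2 * q * g * T 0 (Suc 0)
    + 2 * p * g * T 1 (Suc 0) + r ^ 2 * T 0 2 + 2 * q * r * T 1 2
    + (2 * p * r + q ^ 2) * T 2 2 + 2 * p * q * T 3 2 + p ^ 2 * T 4 2"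
  unfolding phi_power_2
  by (simp only: distrib_left distrib_right mono_mult sum.distrib sum_mono,
      simp flip: numeral_2_eq_2, algebra)

lemma sum_phi_power_4:
  "(\<Sum>z\<in>UNIV - {0}. phi p q r z ^ 4) =
    g ^ 4 * T (-4) 0 + r * g ^ 3 * T (-3) (Suc 0) + q * g ^ 3 * T (-2) (Suc 0)
    + p * g ^ 3 * T (-1) (Suc 0) + r ^ 3 * g * T (-1) 3 + q ^ 3 * g * T 2 3
    + p ^ 3 * g * T 5 3 + r ^ 4 * T 0 4 + q * r ^ 3 * T 1 4 + p * r ^ 3 * T 2 4
    + q ^ 3 * r * T 3 4 + q ^ 4 * T 4 4 + p * q ^ 3 * T 5 4 + p ^ 3 * r * T 6 4
    + p ^ 3 * q * T 7 4 + p ^ 4 * T 8 4"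
  unfolding phi_power_4
  by (simp only: distrib_left distrib_right mono_mult sum.distrib sum_mono,
      simp flip: numeral_2_eq_2, algebra)

lemma sum_phi_power_5:
  "(\<Sum>z\<in>UNIV - {0}. phi p q r z ^ 5) =
    g ^ 5 * T (-5) 0 + 2 * r * g ^ 4 * T (-4) (Suc 0) + 2 * q * g ^ 4 * T (-3) (Suc 0)
    + 2 * p * g ^ 4 * T (-2) (Suc 0) + r ^ 2 * g ^ 3 * T (-3) 2
    + 2 * q * r * g ^ 3 * T (-2) 2 + (2 * p * r * g ^ 3 + q ^ 2 * g ^ 3) * T (-1) 2
    + 2 * p * q * g ^ 3 * T 0 2 + p ^ 2 * g ^ 3 * T 1 2 + r ^ 3 * g ^ 2 * T (-2) 3
    + q ^ 3 * g ^ 2 * T 1 3 + p ^ 3 * g ^ 2 * T 4 3 + 2 * r ^ 4 * g * T (-1) 4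
    + 2 * q * r ^ 3 * g * T 0 4 + 2 * p * r ^ 3 * g * T 1 4 + 2 * q ^ 3 * r * g * T 2 4
    + 2 * q ^ 4 * g * T 3 4 + 2 * p * q ^ 3 * g * T 4 4 + 2 * p ^ 3 * r * g * T 5 4
    + 2 * p ^ 3 * q * g * T 6 4 + 2 * p ^ 4 * g * T 7 4 + r ^ 5 * T 0 5
    + 2 * q * r ^ 4 * T 1 5 + (2 * p * r ^ 4 + q ^ 2 * r ^ 3) * T 2 5
    + (2 * p * q * r ^ 3 + q ^ 3 * r ^ 2) * T 3 5 + (p ^ 2 * r ^ 3 + 2 * q ^ 4 * r) * T 4 5
    + (2 * p * q ^ 3 * r + q ^ 5) * T 5 5 + (p ^ 3 * r ^ 2 + 2 * p * q ^ 4) * T 6 5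
    + (2 * p ^ 3 * q * r + p ^ 2 * q ^ 3) * T 7 5 + (2 * p ^ 4 * r + p ^ 3 * q ^ 2) * T 8 5
    + 2 * p ^ 4 * q * T 9 5 + p ^ 5 * T 10 5"
  unfolding phi_power_5
  by (simp only: distrib_left distrib_right mono_mult sum.distrib sum_mono,
      simp flip: numeral_2_eq_2, algebra)

lemma sum_phi_power_7:
  "(\<Sum>z\<in>UNIV - {0}. phi p q r z ^ 7) =
    g ^ 7 * T (-7) 0 + r * g ^ 6 * T (-6) (Suc 0) + q * g ^ 6 * T (-5) (Suc 0)
    + p * g ^ 6 * T (-4) (Suc 0) + 2 * r ^ 3 * g ^ 4 * T (-4) 3
    + 2 * q ^ 3 * g ^ 4 * T (-1) 3 + 2 * p ^ 3 * g ^ 4 * T 2 3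
    + 2 * r ^ 4 * g ^ 3 * T (-3) 4 + 2 * q * r ^ 3 * g ^ 3 * T (-2) 4
    + 2 * p * r ^ 3 * g ^ 3 * T (-1) 4 + 2 * q ^ 3 * r * g ^ 3 * T 0 4
    + 2 * q ^ 4 * g ^ 3 * T 1 4 + 2 * p * q ^ 3 * g ^ 3 * T 2 4
    + 2 * p ^ 3 * r * g ^ 3 * T 3 4 + 2 * p ^ 3 * q * g ^ 3 * T 4 4
    + 2 * p ^ 4 * g ^ 3 * T 5 4 + r ^ 6 * g * T (-1) 6 + 2 * q ^ 3 * r ^ 3 * g * T 2 6
    + (2 * p ^ 3 * r ^ 3 * g + q ^ 6 * g) * T 5 6 + 2 * p ^ 3 * q ^ 3 * g * T 8 6
    + p ^ 6 * g * T 11 6 + r ^ 7 * T 0 7 + q * r ^ 6 * T 1 7 + p * r ^ 6 * T 2 7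
    + 2 * q ^ 3 * r ^ 4 * T 3 7 + 2 * q ^ 4 * r ^ 3 * T 4 7 + 2 * p * q ^ 3 * r ^ 3 * T 5 7
    + (2 * p ^ 3 * r ^ 4 + q ^ 6 * r) * T 6 7 + (2 * p ^ 3 * q * r ^ 3 + q ^ 7) * T 7 7
    + (2 * p ^ 4 * r ^ 3 + p * q ^ 6) * T 8 7 + 2 * p ^ 3 * q ^ 3 * r * T 9 7
    + 2 * p ^ 3 * q ^ 4 * T 10 7 + 2 * p ^ 4 * q ^ 3 * T 11 7 + p ^ 6 * r * T 12 7
    + p ^ 6 * q * T 13 7 + p ^ 7 * T 14 7"
  unfolding phi_power_7
  by (simp only: distrib_left distrib_right mono_mult sum.distrib sum_mono,
      simp flip: numeral_2_eq_2, algebra)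

section \<open>Relations between \<open>a\<close>, \<open>\<beta>\<close> and \<open>g\<close>, with
  \<open>b\<close> standing for \<open>\<beta>\<close>\<close>

lemma phi_relation_2:
  fixes a b :: 'a
  assumes "(\<Sum>z\<in>UNIV - {0}. phi (- b) (b - a) (b * g) z ^ 2) = 0"
  shows "- (a ^ 2) - a * b + a - b ^ 2 * g - b * g = 0"
proof -
  define p q r where pqr: "p = - b" "q = b - a" "r = b * g"
  \<comment> \<open>The factor \<open>g ^ 2\<close> clears the denominators of all values of
    \<open>T\<close> that occur; for exponents 4, 5 and 7 the factors \<open>g ^ 4\<close>,
    \<open>g ^ 5\<close> and \<open>g ^ 7\<close> do the same.\<close>
  have "0 = g ^ 2 * (\<Sum>z\<in>UNIV - {0}. phi p q r z ^ 2)"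
    using assms by (simp add: pqr)
  also have "\<dots> = g ^ 2 * (g ^ 2) * T (-2) 0 + (2 * r * g) * (g ^ 2 * T (-1) (Suc 0))
      + (2 * q * g) * g * (g * T 0 (Suc 0)) + (2 * p * g) * g ^ 2 * (T 1 (Suc 0))
      + (r ^ 2) * (g ^ 2 * T 0 2) + (2 * q * r) * g ^ 2 * (T 1 2)
      + (2 * p * r + q ^ 2) * g ^ 2 * (T 2 2) + (2 * p * q) * g ^ 2 * (T 3 2)
      + (p ^ 2) * g ^ 2 * (T 4 2)"
    unfolding sum_phi_power_2 by algebra
  \<comment> \<open>After the table is inserted, the same power of \<open>g\<close> splits off
    again, up to a multiple of 3, and is cancelled at the end.\<close>
  also have "\<dots> = g ^ 2 * (- (a ^ 2) - a * b + a - b ^ 2 * g - b * g)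
      + 3 * (a * b * g ^ 2 - a * g ^ 2 + b ^ 2 * g ^ 3 - b ^ 2 * g ^ 2 + b * g ^ 3)"
        unfolding T_0_1 T_0_2 T_1[of "Suc 0"] T_1[of 2] T_2_2 T_3[of 2, simplified] T_4_2 T_m1_1
      T_neg_0(2) pqr by algebra
  finally show ?thesis using g_neq_0 by (simp add: three_eq_0)
qed

lemma phi_relation_4:
  fixes a b :: 'a
  assumes "(\<Sum>z\<in>UNIV - {0}. phi (- b) (b - a) (b * g) z ^ 4) = 0"
  shows "a ^ 4 + a ^ 3 * b * g - a ^ 3 * g - a * b ^ 3 * g + a * b ^ 3 + a * g - a - b ^ 4 * g ^ 3
    + b ^ 4 * g ^ 2 + b ^ 4 * g + b ^ 3 * g ^ 3 + b * g = 0"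
proof -
  define p q r where pqr: "p = - b" "q = b - a" "r = b * g"
  have "0 = g ^ 4 * (\<Sum>z\<in>UNIV - {0}. phi p q r z ^ 4)"
    using assms by (simp add: pqr)
  also have "\<dots> = g ^ 4 * (g ^ 4) * T (-4) 0 + (r * g ^ 3) * (g ^ 4 * T (-3) (Suc 0))
      + (q * g ^ 3) * g * (g ^ 3 * T (-2) (Suc 0))
      + (p * g ^ 3) * g ^ 2 * (g ^ 2 * T (-1) (Suc 0))
      + (r ^ 3 * g) * g * (g ^ 3 * T (-1) 3) + (q ^ 3 * g) * g ^ 4 * (T 2 3)
      + (p ^ 3 * g) * g ^ 4 * (T 5 3) + (r ^ 4) * (g ^ 4 * T 0 4)
      + (q * r ^ 3) * g ^ 4 * (T 1 4) + (p * r ^ 3) * g ^ 4 * (T 2 4)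
      + (q ^ 3 * r) * g ^ 4 * (T 3 4) + (q ^ 4) * g ^ 4 * (T 4 4)
      + (p * q ^ 3) * g ^ 4 * (T 5 4) + (p ^ 3 * r) * g ^ 4 * (T 6 4)
      + (p ^ 3 * q) * g ^ 4 * (T 7 4) + (p ^ 4) * g ^ 4 * (T 8 4)"
    unfolding sum_phi_power_4 by algebra
  also have "\<dots> = g ^ 4 * (a ^ 4 + a ^ 3 * b * g - a ^ 3 * g - a * b ^ 3 * g + a * b ^ 3 + a * g - a - b ^ 4 * g ^ 3
      + b ^ 4 * g ^ 2 + b ^ 4 * g + b ^ 3 * g ^ 3 + b * g)
      + 3 * (- (a ^ 3 * b * g ^ 4) - a ^ 2 * b ^ 2 * g ^ 5 + a ^ 2 * b ^ 2 * g ^ 4 + a ^ 2 * b * g ^ 5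
      + a * b ^ 3 * g ^ 5 - a * b ^ 3 * g ^ 4 - a * b ^ 2 * g ^ 5 - b ^ 4 * g ^ 5
      + b ^ 3 * g ^ 5)"
        unfolding T_0_4 T_1[of 4] T_2_3 T_2_4 T_3[of 4, simplified] T_4_4 T_5_3 T_5_4 T_6_4 T_7_4
      T_8_4 T_m1_1 T_m1_3 T_m2_1 T_m3_1 T_neg_0(4) pqr by algebra
  finally show ?thesis using g_neq_0 by (simp add: three_eq_0)
qed

lemma phi_relation_5:
  fixes a b :: 'a
  assumes "(\<Sum>z\<in>UNIV - {0}. phi (- b) (b - a) (b * g) z ^ 5) = 0"
  shows "- (a ^ 5) - a ^ 4 * b - a ^ 3 * b ^ 2 * g + a ^ 3 * b * g ^ 2 - a ^ 3 * b * g
    + a ^ 2 * b ^ 3 * g - a ^ 2 * g ^ 2 - a ^ 2 * g - a ^ 2 - a * b ^ 4 * g - a * b ^ 3 * g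
    - a * b ^ 3 - a * b * g - a * b + a * g ^ 2 + a * g - a + b ^ 5 * g ^ 2 - b ^ 4 * g ^ 4
    - b ^ 4 * g ^ 3 - b ^ 4 * g ^ 2 + b ^ 4 * g - b ^ 3 * g ^ 3 - b ^ 2 * g ^ 3 + b ^ 2 * g
    - b * g ^ 3 + b * g = 0"
proof -
  define p q r where pqr: "p = - b" "q = b - a" "r = b * g"
  have "0 = g ^ 5 * (\<Sum>z\<in>UNIV - {0}. phi p q r z ^ 5)"
    using assms by (simp add: pqr)
  also have "\<dots> = g ^ 5 * (g ^ 5) * T (-5) 0 + (2 * r * g ^ 4) * (g ^ 5 * T (-4) (Suc 0))
      + (2 * q * g ^ 4) * g * (g ^ 4 * T (-3) (Suc 0))
      + (2 * p * g ^ 4) * g ^ 2 * (g ^ 3 * T (-2) (Suc 0))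
      + (r ^ 2 * g ^ 3) * (g ^ 5 * T (-3) 2)
      + (2 * q * r * g ^ 3) * g ^ 2 * (g ^ 3 * T (-2) 2)
      + (2 * p * r * g ^ 3 + q ^ 2 * g ^ 3) * g ^ 2 * (g ^ 3 * T (-1) 2)
      + (2 * p * q * g ^ 3) * g ^ 3 * (g ^ 2 * T 0 2) + (p ^ 2 * g ^ 3) * g ^ 5 * (T 1 2)
      + (r ^ 3 * g ^ 2) * g ^ 2 * (g ^ 3 * T (-2) 3) + (q ^ 3 * g ^ 2) * g ^ 5 * (T 1 3)
      + (p ^ 3 * g ^ 2) * g ^ 5 * (T 4 3) + (2 * r ^ 4 * g) * (g ^ 5 * T (-1) 4)
      + (2 * q * r ^ 3 * g) * g * (g ^ 4 * T 0 4) + (2 * p * r ^ 3 * g) * g ^ 5 * (T 1 4)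
      + (2 * q ^ 3 * r * g) * g ^ 5 * (T 2 4) + (2 * q ^ 4 * g) * g ^ 5 * (T 3 4)
      + (2 * p * q ^ 3 * g) * g ^ 5 * (T 4 4) + (2 * p ^ 3 * r * g) * g ^ 5 * (T 5 4)
      + (2 * p ^ 3 * q * g) * g ^ 5 * (T 6 4) + (2 * p ^ 4 * g) * g ^ 5 * (T 7 4)
      + (r ^ 5) * (g ^ 5 * T 0 5) + (2 * q * r ^ 4) * g ^ 5 * (T 1 5)
      + (2 * p * r ^ 4 + q ^ 2 * r ^ 3) * g ^ 5 * (T 2 5)
      + (2 * p * q * r ^ 3 + q ^ 3 * r ^ 2) * g ^ 5 * (T 3 5)
      + (p ^ 2 * r ^ 3 + 2 * q ^ 4 * r) * g ^ 5 * (T 4 5)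
      + (2 * p * q ^ 3 * r + q ^ 5) * g ^ 5 * (T 5 5)
      + (p ^ 3 * r ^ 2 + 2 * p * q ^ 4) * g ^ 5 * (T 6 5)
      + (2 * p ^ 3 * q * r + p ^ 2 * q ^ 3) * g ^ 5 * (T 7 5)
      + (2 * p ^ 4 * r + p ^ 3 * q ^ 2) * g ^ 5 * (T 8 5)
      + (2 * p ^ 4 * q) * g ^ 5 * (T 9 5) + (p ^ 5) * g ^ 5 * (T 10 5)"
    unfolding sum_phi_power_5 by algebra
  also have "\<dots> = g ^ 5 * (- (a ^ 5) - a ^ 4 * b - a ^ 3 * b ^ 2 * g + a ^ 3 * b * g ^ 2 - a ^ 3 * b * g
      + a ^ 2 * b ^ 3 * g - a ^ 2 * g ^ 2 - a ^ 2 * g - a ^ 2 - a * b ^ 4 * g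
      - a * b ^ 3 * g - a * b ^ 3 - a * b * g - a * b + a * g ^ 2 + a * g - a
      + b ^ 5 * g ^ 2 - b ^ 4 * g ^ 4 - b ^ 4 * g ^ 3 - b ^ 4 * g ^ 2 + b ^ 4 * g
      - b ^ 3 * g ^ 3 - b ^ 2 * g ^ 3 + b ^ 2 * g - b * g ^ 3 + b * g)
      + 3 * (2 * a ^ 4 * b * g ^ 5 + a ^ 3 * b ^ 2 * g ^ 6 - 3 * a ^ 3 * b ^ 2 * g ^ 5
      - a ^ 3 * b * g ^ 7 + a ^ 3 * b * g ^ 6 - 2 * a ^ 2 * b ^ 3 * g ^ 6
      + 2 * a ^ 2 * b ^ 3 * g ^ 5 + 2 * a ^ 2 * b ^ 2 * g ^ 7 - 2 * a ^ 2 * b ^ 2 * g ^ 6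
      + a * b ^ 4 * g ^ 6 - 2 * a * b ^ 3 * g ^ 7 + 3 * a * b ^ 3 * g ^ 6
      + a * b ^ 3 * g ^ 5 + a * b * g ^ 6 + a * b * g ^ 5 - a * g ^ 7 - a * g ^ 6
      + a * g ^ 5 - b ^ 5 * g ^ 7 + b ^ 5 * g ^ 6 + b ^ 4 * g ^ 9 - b ^ 4 * g ^ 8
      - b ^ 4 * g ^ 7 - 3 * b ^ 4 * g ^ 6 + b ^ 2 * g ^ 8 + b ^ 2 * g ^ 7 + b * g ^ 8
      + 2 * b * g ^ 7 - b * g ^ 6)"
        unfolding T_0_2 T_0_4 T_0_5 T_10_5 T_1[of 2] T_1[of 3] T_1[of 4] T_1[of 5] T_2_4 T_2_5
      T_3[of 4, simplified] T_3[of 5, simplified] T_4_3 T_4_4 T_4_5 T_5_4 T_5_5 T_6_4 T_6_5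
      T_7_4 T_7_5 T_8_5 T_9_5 T_m1_2 T_m1_4 T_m2_1 T_m2_2 T_m2_3 T_m3_1 T_m3_2 T_m4_1 T_neg_0(5)
      pqr by algebra
  finally show ?thesis using g_neq_0 by (simp add: three_eq_0)
qed

lemma phi_relation_7:
  fixes a b :: 'a
  assumes "(\<Sum>z\<in>UNIV - {0}. phi (- b) (b - a) (b * g) z ^ 7) = 0"
  shows "- (a ^ 7) - a ^ 6 * b * g + a ^ 6 * b - a ^ 6 * g ^ 2 - a ^ 4 * b ^ 3
    + a ^ 3 * b ^ 4 * g ^ 3 - a ^ 3 * b ^ 4 * g + a ^ 3 * b ^ 4 - a ^ 3 * b ^ 3 * g ^ 4
    + a ^ 3 * b ^ 3 * g ^ 3 - a ^ 3 * b ^ 3 * g ^ 2 - a ^ 3 * b * g ^ 3 - a ^ 3 * b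
    + a ^ 3 * g ^ 3 + a ^ 3 * g ^ 2 + a ^ 3 * g - a * b ^ 6 * g ^ 3 - a * b ^ 3 * g ^ 4
    + a * b ^ 3 * g ^ 3 + a * b ^ 3 * g - a * b ^ 3 - a * g ^ 3 - a * g + a - b ^ 7 * g ^ 4
    + b ^ 7 * g ^ 3 - b ^ 6 * g ^ 6 - b ^ 6 * g ^ 5 + b ^ 6 * g ^ 4 + b ^ 6 * g ^ 3
    + b ^ 4 * g ^ 5 + b ^ 4 * g ^ 4 + b ^ 4 * g ^ 3 + b ^ 4 * g - b ^ 3 * g ^ 5
    - b ^ 3 * g ^ 4 - b * g = 0"
proof -
  define p q r where pqr: "p = - b" "q = b - a" "r = b * g"
  have "0 = g ^ 7 * (\<Sum>z\<in>UNIV - {0}. phi p q r z ^ 7)"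
    using assms by (simp add: pqr)
  also have "\<dots> = g ^ 7 * (g ^ 7) * T (-7) 0 + (r * g ^ 6) * (g ^ 7 * T (-6) (Suc 0))
      + (q * g ^ 6) * g * (g ^ 6 * T (-5) (Suc 0))
      + (p * g ^ 6) * g ^ 2 * (g ^ 5 * T (-4) (Suc 0))
      + (2 * r ^ 3 * g ^ 4) * g * (g ^ 6 * T (-4) 3)
      + (2 * q ^ 3 * g ^ 4) * g ^ 4 * (g ^ 3 * T (-1) 3)
      + (2 * p ^ 3 * g ^ 4) * g ^ 7 * (T 2 3) + (2 * r ^ 4 * g ^ 3) * (g ^ 7 * T (-3) 4)
      + (2 * q * r ^ 3 * g ^ 3) * g * (g ^ 6 * T (-2) 4)
      + (2 * p * r ^ 3 * g ^ 3) * g ^ 2 * (g ^ 5 * T (-1) 4)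
      + (2 * q ^ 3 * r * g ^ 3) * g ^ 3 * (g ^ 4 * T 0 4)
      + (2 * q ^ 4 * g ^ 3) * g ^ 7 * (T 1 4) + (2 * p * q ^ 3 * g ^ 3) * g ^ 7 * (T 2 4)
      + (2 * p ^ 3 * r * g ^ 3) * g ^ 7 * (T 3 4)
      + (2 * p ^ 3 * q * g ^ 3) * g ^ 7 * (T 4 4) + (2 * p ^ 4 * g ^ 3) * g ^ 7 * (T 5 4)
      + (r ^ 6 * g) * g * (g ^ 6 * T (-1) 6) + (2 * q ^ 3 * r ^ 3 * g) * g ^ 7 * (T 2 6)
      + (2 * p ^ 3 * r ^ 3 * g + q ^ 6 * g) * g ^ 7 * (T 5 6)
      + (2 * p ^ 3 * q ^ 3 * g) * g ^ 7 * (T 8 6) + (p ^ 6 * g) * g ^ 7 * (T 11 6)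
      + (r ^ 7) * (g ^ 7 * T 0 7) + (q * r ^ 6) * g ^ 7 * (T 1 7)
      + (p * r ^ 6) * g ^ 7 * (T 2 7) + (2 * q ^ 3 * r ^ 4) * g ^ 7 * (T 3 7)
      + (2 * q ^ 4 * r ^ 3) * g ^ 7 * (T 4 7) + (2 * p * q ^ 3 * r ^ 3) * g ^ 7 * (T 5 7)
      + (2 * p ^ 3 * r ^ 4 + q ^ 6 * r) * g ^ 7 * (T 6 7)
      + (2 * p ^ 3 * q * r ^ 3 + q ^ 7) * g ^ 7 * (T 7 7)
      + (2 * p ^ 4 * r ^ 3 + p * q ^ 6) * g ^ 7 * (T 8 7)
      + (2 * p ^ 3 * q ^ 3 * r) * g ^ 7 * (T 9 7) + (2 * p ^ 3 * q ^ 4) * g ^ 7 * (T 10 7)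
      + (2 * p ^ 4 * q ^ 3) * g ^ 7 * (T 11 7) + (p ^ 6 * r) * g ^ 7 * (T 12 7)
      + (p ^ 6 * q) * g ^ 7 * (T 13 7) + (p ^ 7) * g ^ 7 * (T 14 7)"
    unfolding sum_phi_power_7 by algebra
  also have "\<dots> = g ^ 7 * (- (a ^ 7) - a ^ 6 * b * g + a ^ 6 * b - a ^ 6 * g ^ 2 - a ^ 4 * b ^ 3
      + a ^ 3 * b ^ 4 * g ^ 3 - a ^ 3 * b ^ 4 * g + a ^ 3 * b ^ 4 - a ^ 3 * b ^ 3 * g ^ 4
      + a ^ 3 * b ^ 3 * g ^ 3 - a ^ 3 * b ^ 3 * g ^ 2 - a ^ 3 * b * g ^ 3 - a ^ 3 * b
      + a ^ 3 * g ^ 3 + a ^ 3 * g ^ 2 + a ^ 3 * g - a * b ^ 6 * g ^ 3 - a * b ^ 3 * g ^ 4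
      + a * b ^ 3 * g ^ 3 + a * b ^ 3 * g - a * b ^ 3 - a * g ^ 3 - a * g + a
      - b ^ 7 * g ^ 4 + b ^ 7 * g ^ 3 - b ^ 6 * g ^ 6 - b ^ 6 * g ^ 5 + b ^ 6 * g ^ 4
      + b ^ 6 * g ^ 3 + b ^ 4 * g ^ 5 + b ^ 4 * g ^ 4 + b ^ 4 * g ^ 3 + b ^ 4 * g
      - b ^ 3 * g ^ 5 - b ^ 3 * g ^ 4 - b * g)
      + 3 * (2 * a ^ 6 * b * g ^ 7 + 2 * a ^ 5 * b ^ 2 * g ^ 8 - 7 * a ^ 5 * b ^ 2 * g ^ 7
      + 2 * a ^ 5 * b * g ^ 9 - 5 * a ^ 4 * b ^ 3 * g ^ 8 + 12 * a ^ 4 * b ^ 3 * g ^ 7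
      - 5 * a ^ 4 * b ^ 2 * g ^ 9 - a ^ 3 * b ^ 4 * g ^ 10 + 7 * a ^ 3 * b ^ 4 * g ^ 8
      - 12 * a ^ 3 * b ^ 4 * g ^ 7 + a ^ 3 * b ^ 3 * g ^ 11 - a ^ 3 * b ^ 3 * g ^ 10
      + 7 * a ^ 3 * b ^ 3 * g ^ 9 + a ^ 3 * b * g ^ 10 + a ^ 3 * b * g ^ 7 - a ^ 3 * g ^ 10
      - a ^ 3 * g ^ 9 - a ^ 3 * g ^ 8 + 2 * a ^ 2 * b ^ 5 * g ^ 10
      - 5 * a ^ 2 * b ^ 5 * g ^ 8 + 7 * a ^ 2 * b ^ 5 * g ^ 7 - 2 * a ^ 2 * b ^ 4 * g ^ 11
      + 2 * a ^ 2 * b ^ 4 * g ^ 10 - 5 * a ^ 2 * b ^ 4 * g ^ 9 - 2 * a ^ 2 * b ^ 2 * g ^ 10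
      - 2 * a ^ 2 * b ^ 2 * g ^ 7 + 2 * a ^ 2 * b * g ^ 10 + 2 * a ^ 2 * b * g ^ 9
      + 2 * a ^ 2 * b * g ^ 8 - a * b ^ 6 * g ^ 10 + 2 * a * b ^ 6 * g ^ 8
      - 2 * a * b ^ 6 * g ^ 7 + 2 * a * b ^ 5 * g ^ 11 - 2 * a * b ^ 5 * g ^ 10
      + 2 * a * b ^ 5 * g ^ 9 + a * b ^ 3 * g ^ 11 + 3 * a * b ^ 3 * g ^ 10
      - a * b ^ 3 * g ^ 8 + 3 * a * b ^ 3 * g ^ 7 - 2 * a * b ^ 2 * g ^ 10
      - 2 * a * b ^ 2 * g ^ 9 - 2 * a * b ^ 2 * g ^ 8 + b ^ 7 * g ^ 11 + b ^ 6 * g ^ 12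
      - b ^ 6 * g ^ 11 - b ^ 6 * g ^ 9 - b ^ 4 * g ^ 12 + b ^ 4 * g ^ 11 - b ^ 4 * g ^ 10
      - b ^ 4 * g ^ 8 - 2 * b ^ 4 * g ^ 7 + b ^ 3 * g ^ 12 - b ^ 3 * g ^ 11)"
        unfolding T_0_4 T_0_7 T_10_7 T_11_6 T_11_7 T_12_7 T_13_7 T_14_7 T_1[of 4] T_1[of 7] T_2_3
      T_2_4 T_2_6 T_2_7 T_3[of 4, simplified] T_3[of 7, simplified] T_4_4 T_4_7 T_5_4 T_5_6
      T_5_7 T_6_7 T_7_7 T_8_6 T_8_7 T_9_7 T_m1_3 T_m1_4 T_m1_6 T_m2_4 T_m3_4 T_m4_1 T_m4_3
      T_m5_1 T_m6_1 T_neg_0(7) pqr by algebra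
  finally show ?thesis using g_neq_0 by (simp add: three_eq_0)
qed

end

section \<open>The polynomial system\<close>

context ternary_field
begin

text \<open>Here \<open>b\<close> stands for \<open>\<beta>\<close>. The hypothesis on \<open>g\<close> is the relation for exponent \<open>2\<close>.\<close>

lemma eliminate_g_4:
  fixes a b g :: 'a
  assumes g: "b * (b + 1) * g = - (a * (a + b - 1))"
    and nz: "a \<noteq> 0" "b \<noteq> 0" "a + b - 1 \<noteq> 0"
    and "a ^ 4 + a ^ 3 * b * g - a ^ 3 * g - a * b ^ 3 * g + a * b ^ 3 + a * g - a - b ^ 4 * g ^ 3
      + b ^ 4 * g ^ 2 + b ^ 4 * g + b ^ 3 * g ^ 3 + b * g = 0"
  shows "a ^ 4 * b ^ 2 - a ^ 4 * b + a ^ 3 * b ^ 3 + a ^ 3 * b ^ 2 + a ^ 3 + a ^ 2 * b ^ 3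
    + a * b ^ 5 + a * b ^ 2 - a * b - a - b ^ 5 - b ^ 2 = 0"
proof -
  \<comment> \<open>The relation has degree three in \<open>g\<close>. Multiplying by the third
    power turns every \<open>g\<close> into \<open>b * (b + 1) * g\<close>, for which the hypothesis
    supplies a polynomial in \<open>a\<close> and \<open>b\<close>.\<close>
  have "0 = (b * (b + 1)) ^ 3 * (a ^ 4 + a ^ 3 * b * g - a ^ 3 * g - a * b ^ 3 * g + a * b ^ 3 + a * g - a - b ^ 4 * g ^ 3
      + b ^ 4 * g ^ 2 + b ^ 4 * g + b ^ 3 * g ^ 3 + b * g)"
    using assms(5) by simp
  also have "\<dots> = (a ^ 4 + a * b ^ 3 - a) * (b * (b + 1)) ^ 3
      + (a ^ 3 * b - a ^ 3 - a * b ^ 3 + a + b ^ 4 + b) * (b * (b + 1)) ^ 2 * (b * (b + 1) * g)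
      + (b ^ 4) * (b * (b + 1)) * (b * (b + 1) * g) ^ 2
      + (- (b ^ 4) + b ^ 3) * (b * (b + 1) * g) ^ 3"
    by algebra
  also have "\<dots> = (a ^ 4 + a * b ^ 3 - a) * (b * (b + 1)) ^ 3
      + (a ^ 3 * b - a ^ 3 - a * b ^ 3 + a + b ^ 4 + b) * (b * (b + 1)) ^ 2 * (- (a * (a + b - 1)))
      + (b ^ 4) * (b * (b + 1)) * (- (a * (a + b - 1))) ^ 2
      + (- (b ^ 4) + b ^ 3) * (- (a * (a + b - 1))) ^ 3"
    unfolding g ..
  \<comment> \<open>Modulo 3 the result has the factor \<open>a * b ^ 2 * (a + b - 1)\<close>,
    nonzero by \<open>nz\<close>, so the cofactor must vanish.\<close>
  also have "\<dots> = a * b ^ 2 * (a + b - 1) * (a ^ 4 * b ^ 2 - a ^ 4 * b + a ^ 3 * b ^ 3 + a ^ 3 * b ^ 2 + a ^ 3 + a ^ 2 * b ^ 3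
      + a * b ^ 5 + a * b ^ 2 - a * b - a - b ^ 5 - b ^ 2)
      + 3 * (- (2 * a ^ 5 * b ^ 4) + a ^ 5 * b ^ 3 + a ^ 4 * b ^ 6 - 2 * a ^ 4 * b ^ 5
      + 5 * a ^ 4 * b ^ 4 - a ^ 4 * b ^ 3 + a ^ 3 * b ^ 7 - a ^ 3 * b ^ 6
      + 2 * a ^ 3 * b ^ 5 - 2 * a ^ 3 * b ^ 4 - a ^ 2 * b ^ 6 - a ^ 2 * b ^ 5 + a * b ^ 8
      + a * b ^ 7 - a * b ^ 5 - a * b ^ 4)"
    by algebra
  finally show ?thesis using nz by (simp add: three_eq_0)
qed

lemma eliminate_g_5:
  fixes a b g :: 'a
  assumes g: "b * (b + 1) * g = - (a * (a + b - 1))"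
    and nz: "a \<noteq> 0" "b \<noteq> 0" "a + b - 1 \<noteq> 0"
    and "- (a ^ 5) - a ^ 4 * b - a ^ 3 * b ^ 2 * g + a ^ 3 * b * g ^ 2 - a ^ 3 * b * g
      + a ^ 2 * b ^ 3 * g - a ^ 2 * g ^ 2 - a ^ 2 * g - a ^ 2 - a * b ^ 4 * g
      - a * b ^ 3 * g - a * b ^ 3 - a * b * g - a * b + a * g ^ 2 + a * g - a
      + b ^ 5 * g ^ 2 - b ^ 4 * g ^ 4 - b ^ 4 * g ^ 3 - b ^ 4 * g ^ 2 + b ^ 4 * g
      - b ^ 3 * g ^ 3 - b ^ 2 * g ^ 3 + b ^ 2 * g - b * g ^ 3 + b * g = 0"
  shows "- (a ^ 6 * b) + a ^ 5 * b ^ 2 - a ^ 5 * b + a ^ 5 - a ^ 4 * b ^ 3 - a ^ 4 + a ^ 3 * b ^ 4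
    - a ^ 3 * b ^ 3 - a ^ 3 * b ^ 2 + a ^ 3 * b + a ^ 3 + a ^ 2 * b ^ 5 + a ^ 2 * b ^ 4
    + a ^ 2 * b ^ 3 - a ^ 2 * b - a * b ^ 7 - a * b ^ 6 + a * b ^ 5 + a * b ^ 4 - a * b ^ 3
    - a + b ^ 7 + b ^ 6 - b ^ 5 + b ^ 4 + b ^ 3 - b ^ 2 = 0"
proof -
  \<comment> \<open>Here the degree in \<open>g\<close> is four.\<close>
  have "0 = (b * (b + 1)) ^ 4 * (- (a ^ 5) - a ^ 4 * b - a ^ 3 * b ^ 2 * g + a ^ 3 * b * g ^ 2 - a ^ 3 * b * g
      + a ^ 2 * b ^ 3 * g - a ^ 2 * g ^ 2 - a ^ 2 * g - a ^ 2 - a * b ^ 4 * g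
      - a * b ^ 3 * g - a * b ^ 3 - a * b * g - a * b + a * g ^ 2 + a * g - a
      + b ^ 5 * g ^ 2 - b ^ 4 * g ^ 4 - b ^ 4 * g ^ 3 - b ^ 4 * g ^ 2 + b ^ 4 * g
      - b ^ 3 * g ^ 3 - b ^ 2 * g ^ 3 + b ^ 2 * g - b * g ^ 3 + b * g)"
    using assms(5) by simp
  also have "\<dots> = (- (a ^ 5) - a ^ 4 * b - a ^ 2 - a * b ^ 3 - a * b - a) * (b * (b + 1)) ^ 4
      + (- (a ^ 3 * b ^ 2) - a ^ 3 * b + a ^ 2 * b ^ 3 - a ^ 2 - a * b ^ 4 - a * b ^ 3 - a * b + a + b ^ 4 + b ^ 2 + b) * (b * (b + 1)) ^ 3 * (b * (b + 1) * g)
      + (a ^ 3 * b - a ^ 2 + a + b ^ 5 - b ^ 4) * (b * (b + 1)) ^ 2 * (b * (b + 1) * g) ^ 2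
      + (- (b ^ 4) - b ^ 3 - b ^ 2 - b) * (b * (b + 1)) * (b * (b + 1) * g) ^ 3
      + (- (b ^ 4)) * (b * (b + 1) * g) ^ 4"
    by algebra
  also have "\<dots> = (- (a ^ 5) - a ^ 4 * b - a ^ 2 - a * b ^ 3 - a * b - a) * (b * (b + 1)) ^ 4
      + (- (a ^ 3 * b ^ 2) - a ^ 3 * b + a ^ 2 * b ^ 3 - a ^ 2 - a * b ^ 4 - a * b ^ 3 - a * b + a + b ^ 4 + b ^ 2 + b) * (b * (b + 1)) ^ 3 * (- (a * (a + b - 1)))
      + (a ^ 3 * b - a ^ 2 + a + b ^ 5 - b ^ 4) * (b * (b + 1)) ^ 2 * (- (a * (a + b - 1))) ^ 2
      + (- (b ^ 4) - b ^ 3 - b ^ 2 - b) * (b * (b + 1)) * (- (a * (a + b - 1))) ^ 3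
      + (- (b ^ 4)) * (- (a * (a + b - 1))) ^ 4"
    unfolding g ..
  also have "\<dots> = a * b ^ 3 * (a + b - 1) * (- (a ^ 6 * b) + a ^ 5 * b ^ 2 - a ^ 5 * b + a ^ 5 - a ^ 4 * b ^ 3 - a ^ 4 + a ^ 3 * b ^ 4
      - a ^ 3 * b ^ 3 - a ^ 3 * b ^ 2 + a ^ 3 * b + a ^ 3 + a ^ 2 * b ^ 5 + a ^ 2 * b ^ 4
      + a ^ 2 * b ^ 3 - a ^ 2 * b - a * b ^ 7 - a * b ^ 6 + a * b ^ 5 + a * b ^ 4
      - a * b ^ 3 - a + b ^ 7 + b ^ 6 - b ^ 5 + b ^ 4 + b ^ 3 - b ^ 2)
      + 3 * (- (a ^ 7 * b ^ 5) + 2 * a ^ 7 * b ^ 4 - a ^ 6 * b ^ 6 + 6 * a ^ 6 * b ^ 5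
      - 3 * a ^ 6 * b ^ 4 + 5 * a ^ 5 * b ^ 6 - 5 * a ^ 5 * b ^ 5 + a ^ 5 * b ^ 4
      - a ^ 4 * b ^ 8 - a ^ 4 * b ^ 7 - 6 * a ^ 4 * b ^ 6 + a ^ 4 * b ^ 5 + a ^ 4 * b ^ 4
      + a ^ 3 * b ^ 10 + a ^ 3 * b ^ 9 + 2 * a ^ 3 * b ^ 7 + 4 * a ^ 3 * b ^ 6
      - 2 * a ^ 3 * b ^ 4 + a ^ 2 * b ^ 11 - 2 * a ^ 2 * b ^ 9 - a ^ 2 * b ^ 8
      - 3 * a ^ 2 * b ^ 7 - 6 * a ^ 2 * b ^ 6 - 3 * a ^ 2 * b ^ 5 - a * b ^ 11
      - 2 * a * b ^ 10 - 2 * a * b ^ 9 - 4 * a * b ^ 8 - 4 * a * b ^ 7 - 2 * a * b ^ 6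
      - a * b ^ 5)"
    by algebra
  finally show ?thesis using nz by (simp add: three_eq_0)
qed

lemma eliminate_g_7:
  fixes a b g :: 'a
  assumes g: "b * (b + 1) * g = - (a * (a + b - 1))"
    and nz: "a \<noteq> 0" "b \<noteq> 0" "a + b - 1 \<noteq> 0"
    and "- (a ^ 7) - a ^ 6 * b * g + a ^ 6 * b - a ^ 6 * g ^ 2 - a ^ 4 * b ^ 3
      + a ^ 3 * b ^ 4 * g ^ 3 - a ^ 3 * b ^ 4 * g + a ^ 3 * b ^ 4 - a ^ 3 * b ^ 3 * g ^ 4
      + a ^ 3 * b ^ 3 * g ^ 3 - a ^ 3 * b ^ 3 * g ^ 2 - a ^ 3 * b * g ^ 3 - a ^ 3 * b
      + a ^ 3 * g ^ 3 + a ^ 3 * g ^ 2 + a ^ 3 * g - a * b ^ 6 * g ^ 3 - a * b ^ 3 * g ^ 4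
      + a * b ^ 3 * g ^ 3 + a * b ^ 3 * g - a * b ^ 3 - a * g ^ 3 - a * g + a
      - b ^ 7 * g ^ 4 + b ^ 7 * g ^ 3 - b ^ 6 * g ^ 6 - b ^ 6 * g ^ 5 + b ^ 6 * g ^ 4
      + b ^ 6 * g ^ 3 + b ^ 4 * g ^ 5 + b ^ 4 * g ^ 4 + b ^ 4 * g ^ 3 + b ^ 4 * g
      - b ^ 3 * g ^ 5 - b ^ 3 * g ^ 4 - b * g = 0"
  shows "- (a ^ 10 * b ^ 3) - a ^ 9 * b ^ 2 - a ^ 8 * b ^ 5 - a ^ 8 * b ^ 4 + a ^ 8 * b ^ 3
    - a ^ 8 * b ^ 2 - a ^ 7 * b ^ 7 + a ^ 7 * b ^ 6 + a ^ 7 * b ^ 4 + a ^ 7 * b - a ^ 7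
    + a ^ 6 * b ^ 8 + a ^ 6 * b ^ 7 + a ^ 6 * b ^ 6 - a ^ 6 * b ^ 5 - a ^ 6 * b ^ 4
    + a ^ 6 * b ^ 3 - a ^ 6 * b ^ 2 - a ^ 6 * b - a ^ 6 - a ^ 5 * b ^ 9 + a ^ 5 * b ^ 6
    + a ^ 5 * b ^ 5 - a ^ 5 * b ^ 4 + a ^ 5 * b ^ 2 - a ^ 4 * b ^ 9 + a ^ 4 * b ^ 6
    + a ^ 4 * b ^ 3 - a ^ 4 * b + a ^ 4 - a ^ 3 * b ^ 10 + a ^ 3 * b ^ 9 - a ^ 3 * b ^ 8
    - a ^ 3 * b ^ 7 + a ^ 3 * b ^ 5 + a ^ 3 * b ^ 3 + a ^ 3 * b ^ 2 + a ^ 3 * b + a ^ 3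
    - a ^ 2 * b ^ 11 - a ^ 2 * b ^ 10 + a ^ 2 * b ^ 9 - a ^ 2 * b ^ 8 - a ^ 2 * b ^ 7
    - a ^ 2 * b ^ 3 - a * b ^ 8 - a * b ^ 7 + a * b ^ 6 - a * b ^ 4 + a * b ^ 3 + a * b ^ 2
    + b ^ 11 + b ^ 9 + b ^ 8 + b ^ 7 + b ^ 6 + b ^ 4 = 0"
proof -
  \<comment> \<open>Here the degree in \<open>g\<close> is six.\<close>
  have "0 = (b * (b + 1)) ^ 6 * (- (a ^ 7) - a ^ 6 * b * g + a ^ 6 * b - a ^ 6 * g ^ 2 - a ^ 4 * b ^ 3
      + a ^ 3 * b ^ 4 * g ^ 3 - a ^ 3 * b ^ 4 * g + a ^ 3 * b ^ 4 - a ^ 3 * b ^ 3 * g ^ 4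
      + a ^ 3 * b ^ 3 * g ^ 3 - a ^ 3 * b ^ 3 * g ^ 2 - a ^ 3 * b * g ^ 3 - a ^ 3 * b
      + a ^ 3 * g ^ 3 + a ^ 3 * g ^ 2 + a ^ 3 * g - a * b ^ 6 * g ^ 3 - a * b ^ 3 * g ^ 4
      + a * b ^ 3 * g ^ 3 + a * b ^ 3 * g - a * b ^ 3 - a * g ^ 3 - a * g + a
      - b ^ 7 * g ^ 4 + b ^ 7 * g ^ 3 - b ^ 6 * g ^ 6 - b ^ 6 * g ^ 5 + b ^ 6 * g ^ 4
      + b ^ 6 * g ^ 3 + b ^ 4 * g ^ 5 + b ^ 4 * g ^ 4 + b ^ 4 * g ^ 3 + b ^ 4 * g
      - b ^ 3 * g ^ 5 - b ^ 3 * g ^ 4 - b * g)"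
    using assms(5) by simp
  also have "\<dots> = (- (a ^ 7) + a ^ 6 * b - a ^ 4 * b ^ 3 + a ^ 3 * b ^ 4 - a ^ 3 * b - a * b ^ 3 + a) * (b * (b + 1)) ^ 6
      + (- (a ^ 6 * b) - a ^ 3 * b ^ 4 + a ^ 3 + a * b ^ 3 - a + b ^ 4 - b) * (b * (b + 1)) ^ 5 * (b * (b + 1) * g)
      + (- (a ^ 6) - a ^ 3 * b ^ 3 + a ^ 3) * (b * (b + 1)) ^ 4 * (b * (b + 1) * g) ^ 2
      + (a ^ 3 * b ^ 4 + a ^ 3 * b ^ 3 - a ^ 3 * b + a ^ 3 - a * b ^ 6 + a * b ^ 3 - a + b ^ 7 + b ^ 6 + b ^ 4) * (b * (b + 1)) ^ 3 * (b * (b + 1) * g) ^ 3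
      + (- (a ^ 3 * b ^ 3) - a * b ^ 3 - b ^ 7 + b ^ 6 + b ^ 4 - b ^ 3) * (b * (b + 1)) ^ 2 * (b * (b + 1) * g) ^ 4
      + (- (b ^ 6) + b ^ 4 - b ^ 3) * (b * (b + 1)) * (b * (b + 1) * g) ^ 5
      + (- (b ^ 6)) * (b * (b + 1) * g) ^ 6"
    by algebra
  also have "\<dots> = (- (a ^ 7) + a ^ 6 * b - a ^ 4 * b ^ 3 + a ^ 3 * b ^ 4 - a ^ 3 * b - a * b ^ 3 + a) * (b * (b + 1)) ^ 6
      + (- (a ^ 6 * b) - a ^ 3 * b ^ 4 + a ^ 3 + a * b ^ 3 - a + b ^ 4 - b) * (b * (b + 1)) ^ 5 * (- (a * (a + b - 1)))
      + (- (a ^ 6) - a ^ 3 * b ^ 3 + a ^ 3) * (b * (b + 1)) ^ 4 * (- (a * (a + b - 1))) ^ 2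
      + (a ^ 3 * b ^ 4 + a ^ 3 * b ^ 3 - a ^ 3 * b + a ^ 3 - a * b ^ 6 + a * b ^ 3 - a + b ^ 7 + b ^ 6 + b ^ 4) * (b * (b + 1)) ^ 3 * (- (a * (a + b - 1))) ^ 3
      + (- (a ^ 3 * b ^ 3) - a * b ^ 3 - b ^ 7 + b ^ 6 + b ^ 4 - b ^ 3) * (b * (b + 1)) ^ 2 * (- (a * (a + b - 1))) ^ 4
      + (- (b ^ 6) + b ^ 4 - b ^ 3) * (b * (b + 1)) * (- (a * (a + b - 1))) ^ 5
      + (- (b ^ 6)) * (- (a * (a + b - 1))) ^ 6"
    unfolding g ..
  also have "\<dots> = a * b ^ 3 * (a + b - 1) * (- (a ^ 10 * b ^ 3) - a ^ 9 * b ^ 2 - a ^ 8 * b ^ 5 - a ^ 8 * b ^ 4 + a ^ 8 * b ^ 3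
      - a ^ 8 * b ^ 2 - a ^ 7 * b ^ 7 + a ^ 7 * b ^ 6 + a ^ 7 * b ^ 4 + a ^ 7 * b - a ^ 7
      + a ^ 6 * b ^ 8 + a ^ 6 * b ^ 7 + a ^ 6 * b ^ 6 - a ^ 6 * b ^ 5 - a ^ 6 * b ^ 4
      + a ^ 6 * b ^ 3 - a ^ 6 * b ^ 2 - a ^ 6 * b - a ^ 6 - a ^ 5 * b ^ 9 + a ^ 5 * b ^ 6
      + a ^ 5 * b ^ 5 - a ^ 5 * b ^ 4 + a ^ 5 * b ^ 2 - a ^ 4 * b ^ 9 + a ^ 4 * b ^ 6
      + a ^ 4 * b ^ 3 - a ^ 4 * b + a ^ 4 - a ^ 3 * b ^ 10 + a ^ 3 * b ^ 9 - a ^ 3 * b ^ 8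
      - a ^ 3 * b ^ 7 + a ^ 3 * b ^ 5 + a ^ 3 * b ^ 3 + a ^ 3 * b ^ 2 + a ^ 3 * b + a ^ 3
      - a ^ 2 * b ^ 11 - a ^ 2 * b ^ 10 + a ^ 2 * b ^ 9 - a ^ 2 * b ^ 8 - a ^ 2 * b ^ 7
      - a ^ 2 * b ^ 3 - a * b ^ 8 - a * b ^ 7 + a * b ^ 6 - a * b ^ 4 + a * b ^ 3
      + a * b ^ 2 + b ^ 11 + b ^ 9 + b ^ 8 + b ^ 7 + b ^ 6 + b ^ 4)
      + 3 * (- (2 * a ^ 11 * b ^ 7) + a ^ 11 * b ^ 6 - 6 * a ^ 10 * b ^ 8 + 8 * a ^ 10 * b ^ 7
      - 6 * a ^ 10 * b ^ 6 - 9 * a ^ 9 * b ^ 9 + 16 * a ^ 9 * b ^ 8 - 23 * a ^ 9 * b ^ 7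
      + 10 * a ^ 9 * b ^ 6 + a ^ 9 * b ^ 5 - 2 * a ^ 9 * b ^ 4 - a ^ 8 * b ^ 11
      - 6 * a ^ 8 * b ^ 10 + 19 * a ^ 8 * b ^ 9 - 28 * a ^ 8 * b ^ 8 + 34 * a ^ 8 * b ^ 7
      - 6 * a ^ 8 * b ^ 6 - 7 * a ^ 8 * b ^ 5 + 5 * a ^ 8 * b ^ 4 + a ^ 8 * b ^ 3
      - 2 * a ^ 7 * b ^ 12 - a ^ 7 * b ^ 11 + 4 * a ^ 7 * b ^ 10 - 27 * a ^ 7 * b ^ 9
      + 26 * a ^ 7 * b ^ 8 - 27 * a ^ 7 * b ^ 7 - 3 * a ^ 7 * b ^ 6 + 14 * a ^ 7 * b ^ 5
      - 2 * a ^ 7 * b ^ 4 - a ^ 7 * b ^ 3 - a ^ 6 * b ^ 13 + 5 * a ^ 6 * b ^ 12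
      + 3 * a ^ 6 * b ^ 11 - 5 * a ^ 6 * b ^ 10 + 15 * a ^ 6 * b ^ 9 - 14 * a ^ 6 * b ^ 8
      + 11 * a ^ 6 * b ^ 7 + 11 * a ^ 6 * b ^ 6 - 10 * a ^ 6 * b ^ 5 - a ^ 6 * b ^ 4
      - a ^ 6 * b ^ 3 - a ^ 5 * b ^ 14 + 3 * a ^ 5 * b ^ 13 - 2 * a ^ 5 * b ^ 12
      - a ^ 5 * b ^ 11 + 5 * a ^ 5 * b ^ 10 + a ^ 5 * b ^ 9 + 6 * a ^ 5 * b ^ 8
      - 4 * a ^ 5 * b ^ 7 - 10 * a ^ 5 * b ^ 6 + a ^ 5 * b ^ 5 + a ^ 5 * b ^ 3
      - a ^ 4 * b ^ 15 - a ^ 4 * b ^ 14 - 4 * a ^ 4 * b ^ 13 - 5 * a ^ 4 * b ^ 12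
      - 5 * a ^ 4 * b ^ 11 - 3 * a ^ 4 * b ^ 10 - a ^ 4 * b ^ 9 - 3 * a ^ 4 * b ^ 8
      - a ^ 4 * b ^ 7 + 3 * a ^ 4 * b ^ 6 + a ^ 4 * b ^ 5 + 2 * a ^ 3 * b ^ 15
      + 6 * a ^ 3 * b ^ 14 + 6 * a ^ 3 * b ^ 13 + a ^ 3 * b ^ 12 - 6 * a ^ 3 * b ^ 11
      - 9 * a ^ 3 * b ^ 10 - 6 * a ^ 3 * b ^ 9 + a ^ 3 * b ^ 8 + 4 * a ^ 3 * b ^ 7
      + a ^ 3 * b ^ 6 - a ^ 2 * b ^ 14 - 3 * a ^ 2 * b ^ 13 - 5 * a ^ 2 * b ^ 12
      - 3 * a ^ 2 * b ^ 11 + 2 * a ^ 2 * b ^ 10 + 6 * a ^ 2 * b ^ 9 + 4 * a ^ 2 * b ^ 8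
      - a ^ 2 * b ^ 7 - a ^ 2 * b ^ 6 - a * b ^ 15 - 3 * a * b ^ 14 - 7 * a * b ^ 13
      - 6 * a * b ^ 12 + 6 * a * b ^ 10 + 7 * a * b ^ 9 + 3 * a * b ^ 8 + a * b ^ 7)"
    by algebra
  finally show ?thesis using nz by (simp add: three_eq_0)
qed

text \<open>
  The certificate was found by linear algebra over the prime field in degree \<open>18\<close>.
\<close>

lemma no_common_zero:
  fixes a b :: 'a
  assumes nz: "a \<noteq> 0" "b \<noteq> 0" "b + 1 \<noteq> 0" "a + b - 1 \<noteq> 0"
    and P4: "a ^ 4 * b ^ 2 - a ^ 4 * b + a ^ 3 * b ^ 3 + a ^ 3 * b ^ 2 + a ^ 3 + a ^ 2 * b ^ 3
    + a * b ^ 5 + a * b ^ 2 - a * b - a - b ^ 5 - b ^ 2 = 0"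
    and P5: "- (a ^ 6 * b) + a ^ 5 * b ^ 2 - a ^ 5 * b + a ^ 5 - a ^ 4 * b ^ 3 - a ^ 4 + a ^ 3 * b ^ 4
    - a ^ 3 * b ^ 3 - a ^ 3 * b ^ 2 + a ^ 3 * b + a ^ 3 + a ^ 2 * b ^ 5 + a ^ 2 * b ^ 4
    + a ^ 2 * b ^ 3 - a ^ 2 * b - a * b ^ 7 - a * b ^ 6 + a * b ^ 5 + a * b ^ 4 - a * b ^ 3
    - a + b ^ 7 + b ^ 6 - b ^ 5 + b ^ 4 + b ^ 3 - b ^ 2 = 0"
    and P7: "- (a ^ 10 * b ^ 3) - a ^ 9 * b ^ 2 - a ^ 8 * b ^ 5 - a ^ 8 * b ^ 4 + a ^ 8 * b ^ 3
    - a ^ 8 * b ^ 2 - a ^ 7 * b ^ 7 + a ^ 7 * b ^ 6 + a ^ 7 * b ^ 4 + a ^ 7 * b - a ^ 7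
    + a ^ 6 * b ^ 8 + a ^ 6 * b ^ 7 + a ^ 6 * b ^ 6 - a ^ 6 * b ^ 5 - a ^ 6 * b ^ 4
    + a ^ 6 * b ^ 3 - a ^ 6 * b ^ 2 - a ^ 6 * b - a ^ 6 - a ^ 5 * b ^ 9 + a ^ 5 * b ^ 6
    + a ^ 5 * b ^ 5 - a ^ 5 * b ^ 4 + a ^ 5 * b ^ 2 - a ^ 4 * b ^ 9 + a ^ 4 * b ^ 6
    + a ^ 4 * b ^ 3 - a ^ 4 * b + a ^ 4 - a ^ 3 * b ^ 10 + a ^ 3 * b ^ 9 - a ^ 3 * b ^ 8
    - a ^ 3 * b ^ 7 + a ^ 3 * b ^ 5 + a ^ 3 * b ^ 3 + a ^ 3 * b ^ 2 + a ^ 3 * b + a ^ 3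
    - a ^ 2 * b ^ 11 - a ^ 2 * b ^ 10 + a ^ 2 * b ^ 9 - a ^ 2 * b ^ 8 - a ^ 2 * b ^ 7
    - a ^ 2 * b ^ 3 - a * b ^ 8 - a * b ^ 7 + a * b ^ 6 - a * b ^ 4 + a * b ^ 3 + a * b ^ 2
    + b ^ 11 + b ^ 9 + b ^ 8 + b ^ 7 + b ^ 6 + b ^ 4 = 0"
  shows False
proof -
  let ?P4 = "a ^ 4 * b ^ 2 - a ^ 4 * b + a ^ 3 * b ^ 3 + a ^ 3 * b ^ 2 + a ^ 3 + a ^ 2 * b ^ 3
    + a * b ^ 5 + a * b ^ 2 - a * b - a - b ^ 5 - b ^ 2"
  let ?P5 = "- (a ^ 6 * b) + a ^ 5 * b ^ 2 - a ^ 5 * b + a ^ 5 - a ^ 4 * b ^ 3 - a ^ 4 + a ^ 3 * b ^ 4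
    - a ^ 3 * b ^ 3 - a ^ 3 * b ^ 2 + a ^ 3 * b + a ^ 3 + a ^ 2 * b ^ 5 + a ^ 2 * b ^ 4
    + a ^ 2 * b ^ 3 - a ^ 2 * b - a * b ^ 7 - a * b ^ 6 + a * b ^ 5 + a * b ^ 4 - a * b ^ 3
    - a + b ^ 7 + b ^ 6 - b ^ 5 + b ^ 4 + b ^ 3 - b ^ 2"
  let ?P7 = "- (a ^ 10 * b ^ 3) - a ^ 9 * b ^ 2 - a ^ 8 * b ^ 5 - a ^ 8 * b ^ 4 + a ^ 8 * b ^ 3
    - a ^ 8 * b ^ 2 - a ^ 7 * b ^ 7 + a ^ 7 * b ^ 6 + a ^ 7 * b ^ 4 + a ^ 7 * b - a ^ 7
    + a ^ 6 * b ^ 8 + a ^ 6 * b ^ 7 + a ^ 6 * b ^ 6 - a ^ 6 * b ^ 5 - a ^ 6 * b ^ 4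
    + a ^ 6 * b ^ 3 - a ^ 6 * b ^ 2 - a ^ 6 * b - a ^ 6 - a ^ 5 * b ^ 9 + a ^ 5 * b ^ 6
    + a ^ 5 * b ^ 5 - a ^ 5 * b ^ 4 + a ^ 5 * b ^ 2 - a ^ 4 * b ^ 9 + a ^ 4 * b ^ 6
    + a ^ 4 * b ^ 3 - a ^ 4 * b + a ^ 4 - a ^ 3 * b ^ 10 + a ^ 3 * b ^ 9 - a ^ 3 * b ^ 8
    - a ^ 3 * b ^ 7 + a ^ 3 * b ^ 5 + a ^ 3 * b ^ 3 + a ^ 3 * b ^ 2 + a ^ 3 * b + a ^ 3
    - a ^ 2 * b ^ 11 - a ^ 2 * b ^ 10 + a ^ 2 * b ^ 9 - a ^ 2 * b ^ 8 - a ^ 2 * b ^ 7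
    - a ^ 2 * b ^ 3 - a * b ^ 8 - a * b ^ 7 + a * b ^ 6 - a * b ^ 4 + a * b ^ 3 + a * b ^ 2
    + b ^ 11 + b ^ 9 + b ^ 8 + b ^ 7 + b ^ 6 + b ^ 4"
  \<comment> \<open>The left side is a product of powers of the four quantities assumed nonzero, and
    modulo 3 it lies in the ideal of the three polynomials. Hence every common zero lies on one of
    the four excluded lines.\<close>
  have "a * b ^ 6 * (b + 1) ^ 5 * (a + b - 1) =
      (- (a ^ 8 * b ^ 2) + a ^ 7 * b ^ 4 + a ^ 7 * b ^ 2 - a ^ 7 * b - a ^ 6 * b ^ 5 - a ^ 6 * b
      + a ^ 5 * b ^ 6 - a ^ 5 * b ^ 2 - a ^ 5 * b + a ^ 4 * b ^ 8 - a ^ 4 * b ^ 6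
      + a ^ 4 * b ^ 3 - a ^ 4 + a ^ 3 * b ^ 9 - a ^ 3 * b ^ 7 - a ^ 3 * b ^ 6
      - a ^ 3 * b ^ 4 - a ^ 2 * b ^ 9 + a ^ 2 * b ^ 7 + a ^ 2 * b ^ 6 - a ^ 2 * b ^ 5
      + a ^ 2 * b ^ 2 - a * b ^ 11 - a * b ^ 10 - a * b ^ 9 - a * b ^ 8 - a * b ^ 7
      + a * b ^ 6 - a * b ^ 4 + a * b ^ 3 - a * b ^ 2 + a - b ^ 11 + b ^ 10 + b ^ 7 + b ^ 5
      + b ^ 4 + b) * ?P4
      + (- (a ^ 5 * b) + a ^ 4 + a ^ 3 * b ^ 5 - a ^ 3 * b ^ 3 + a ^ 3 * b ^ 2 + a ^ 3 * b + a ^ 3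
      + a ^ 2 * b ^ 6 - a ^ 2 * b ^ 5 + a ^ 2 * b ^ 3 - a ^ 2 * b ^ 2 + a ^ 2 * b - a ^ 2
      - a * b ^ 9 + a * b ^ 6 + a * b ^ 5 + a * b ^ 3 - a * b - a - b ^ 9 - b ^ 8 - b ^ 4
      + b ^ 3 + b ^ 2 - b) * ?P5
      + (- (a ^ 2 * b) + a ^ 2 + a * b ^ 3 + a * b ^ 2 - a - b ^ 2 + b - 1) * ?P7
      - 3 * (- (a ^ 11 * b ^ 5) + a ^ 10 * b ^ 6 - a ^ 10 * b ^ 4 + a ^ 10 * b ^ 2 - a ^ 10 * b
      - 2 * a ^ 9 * b ^ 7 - a ^ 9 * b ^ 3 + a ^ 9 * b ^ 2 + 2 * a ^ 8 * b ^ 7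
      + a ^ 8 * b ^ 6 - a ^ 8 * b ^ 5 - a ^ 8 * b ^ 3 - a ^ 8 * b ^ 2 + a ^ 7 * b ^ 11
      + a ^ 7 * b ^ 10 - a ^ 7 * b ^ 8 - 2 * a ^ 7 * b ^ 7 - a ^ 7 * b ^ 6 + a ^ 7 * b ^ 5
      - 3 * a ^ 7 * b ^ 4 - a ^ 7 * b ^ 3 + a ^ 7 * b + a ^ 6 * b ^ 10 + a ^ 6 * b ^ 8
      - 2 * a ^ 6 * b ^ 7 - a ^ 6 * b ^ 6 + 2 * a ^ 6 * b ^ 5 - a ^ 6 * b ^ 3
      + 2 * a ^ 6 * b ^ 2 + a ^ 6 - a ^ 5 * b ^ 11 + a ^ 5 * b ^ 9 - a ^ 5 * b ^ 8
      - a ^ 5 * b ^ 6 + 2 * a ^ 5 * b ^ 5 + a ^ 5 * b ^ 2 - 2 * a ^ 4 * b ^ 13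
      - 2 * a ^ 4 * b ^ 10 - 2 * a ^ 4 * b ^ 8 + a ^ 4 * b ^ 7 + 2 * a ^ 4 * b ^ 6
      - a ^ 4 * b ^ 5 + 2 * a ^ 4 * b ^ 4 + 2 * a ^ 4 * b ^ 3 - 2 * a ^ 4 * b ^ 2 - a ^ 4
      - 2 * a ^ 3 * b ^ 14 - 2 * a ^ 3 * b ^ 13 + a ^ 3 * b ^ 12 + a ^ 3 * b ^ 11
      + a ^ 3 * b ^ 10 + a ^ 3 * b ^ 9 + 3 * a ^ 3 * b ^ 8 + a ^ 3 * b ^ 6 - a ^ 3 * b ^ 5
      - a ^ 3 * b ^ 4 + a ^ 3 * b ^ 3 - a ^ 2 * b ^ 14 - a ^ 2 * b ^ 13 - 2 * a ^ 2 * b ^ 12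
      - a ^ 2 * b ^ 11 + a ^ 2 * b ^ 10 - 4 * a ^ 2 * b ^ 9 - 2 * a ^ 2 * b ^ 8
      + a ^ 2 * b ^ 7 - 2 * a ^ 2 * b ^ 6 + a ^ 2 * b ^ 5 - a ^ 2 * b ^ 3 + a ^ 2 * b ^ 2
      + a * b ^ 15 + a * b ^ 14 + 2 * a * b ^ 12 + 2 * a * b ^ 9 + 3 * a * b ^ 7 + a * b ^ 6
      - 3 * a * b ^ 5 - a * b ^ 2 - b ^ 15 - b ^ 12 - b ^ 11 - b ^ 8 - b ^ 7 - b ^ 4)"
    by algebra
  then have "a * b ^ 6 * (b + 1) ^ 5 * (a + b - 1) = 0"
    unfolding P4 P5 P7 by (simp add: three_eq_0)
  then show False using nz by simp
qed

end

section \<open>Permutations of the projective line\<close>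

text \<open>Without poles in the field the map sends finite points to finite points, and by the
  degrees it fixes \<open>Infinity\<close>; so it is bijective exactly if its finite part
  is.\<close>

lemma permutation_ratfun_iff_bij:
  fixes P Q :: "'a::{field, finite} poly"
  assumes "coprime P Q" and nz: "\<And>x. poly Q x \<noteq> 0" and deg: "degree Q < degree P"
  shows "permutation_ratfun (Fract P Q) \<longleftrightarrow> bij (\<lambda>x. poly P x / poly Q x)"
proof -
  have "Q \<noteq> 0" using nz[of 0] by auto
  then have ratfun: "ratfun_map (Fract P Q) = quot_map P Q"
    by (rule ratfun_map_Fract[OF assms(1)])
  define h where "h = (\<lambda>x. poly P x / poly Q x)"
  have Fin: "quot_map P Q (Finite x) = Finite (h x)" for x
    using nz[of x] by (simp add: h_def)
  have Inf: "quot_map P Q Infinity = Infinity"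
    using deg by simp
  have inj: "inj h" if "inj (quot_map P Q)"
  proof (rule injI)
    fix x y assume "h x = h y"
    then have "quot_map P Q (Finite x) = quot_map P Q (Finite y)" by (simp only: Fin)
    then have "Finite x = Finite y" by (rule injD[OF that])
    then show "x = y" by simp
  qed
  have inj': "quot_map P Q v = quot_map P Q w \<Longrightarrow> v = w" if "inj h" for v w
    using injD[OF that] by (cases v; cases w) (simp_all only: Fin Inf proj_line.inject proj_line.distinct)
  have surj: "\<exists>x. y = h x" if "surj (quot_map P Q)" for y
  proof -
    from surjD[OF that, of "Finite y"] obtain w where "Finite y = quot_map P Q w" ..
    then show ?thesis by (cases w) (auto simp only: Fin Inf proj_line.inject proj_line.distinct)
  qed
  have surj': "\<exists>v. w = quot_map P Q v" if "surj h" for w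
  proof (cases w)
    case (Finite y)
    from surjD[OF that, of y] obtain x where "y = h x" ..
    then have "w = quot_map P Q (Finite x)" by (simp only: Finite Fin)
    then show ?thesis ..
  next
    case Infinity
    then have "w = quot_map P Q Infinity" by (simp only: Inf)
    then show ?thesis ..
  qed
  show ?thesis
    unfolding permutation_ratfun_def ratfun h_def[symmetric]
  proof
    assume "bij (quot_map P Q)"
    then have "inj h" "\<forall>y. \<exists>x. y = h x"
      using inj surj by (simp_all only: bij_is_inj bij_is_surj simp_thms)
    then show "bij h" by (simp only: bij_def surj_def simp_thms)
  next
    assume "bij h"
    then have "inj h" "surj h" by (simp_all only: bij_is_inj bij_is_surj)
    then have "inj (quot_map P Q)" "\<forall>w. \<exists>v. w = quot_map P Q v"
      using injI[of "quot_map P Q", OF inj'] surj' by (simp_all only: simp_thms)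
    then show "bij (quot_map P Q)" by (simp only: bij_def surj_def simp_thms)
  qed
qed

lemma irreducible_no_root:
  fixes p :: "'a::field poly"
  assumes irr: "irreducible p" and deg: "2 \<le> degree p"
  shows "poly p x \<noteq> 0"
proof
  assume "poly p x = 0"
  then obtain k where k: "p = [:- x, 1:] * k"
    by (auto simp: poly_eq_0_iff_dvd)
  have "k \<noteq> 0" using k deg by auto
  then have "degree p = degree [:- x, 1:] + degree k"
    unfolding k by (intro degree_mult_eq) auto
  then have "degree k \<noteq> 0" using deg by simp
  then have "\<not> is_unit k" by (auto simp: is_unit_iff_degree \<open>k \<noteq> 0\<close>)
  moreover have "\<not> is_unit [:- x, 1:]" by (simp add: is_unit_iff_degree)
  ultimately show False using irreducibleD[OF irr k] by blast
qed

lemma irreducible_coprime: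
  fixes p q :: "'a::field poly"
  assumes "irreducible q" "\<not> q dvd p"
  shows "coprime p q"
proof (rule coprimeI)
  fix d assume d: "d dvd p" "d dvd q"
  from d(2) obtain k where k: "q = d * k" by blast
  then consider "is_unit d" | "is_unit k" using irreducibleD[OF assms(1)] by blast
  then show "is_unit d"
  proof cases
    case 2
    then obtain l where "1 = k * l" by (rule dvdE)
    then have "d = q * l" using k by (simp add: mult.assoc)
    then have "q dvd p" using d(1) by (metis dvd_triv_left dvd_trans)
    then show ?thesis using assms(2) by simp
  qed
qed

section \<open>Injectivity for \<open>a = 1\<close>, \<open>b = c = 0\<close>, and the form of
  \<open>e\<close> forced by the absence of roots\<close>

context ternary_field
begin

text \<open>
  For distinct arguments \<open>x\<close>, \<open>y\<close> with the same value, the resultant of the cubic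
  with \<open>t\<^sup>2 - (x + y - 1) t + x y\<close> vanishes. The line \<open>b\<^sub>1 t + c\<^sub>1\<close> below is the remainder
  of the cubic modulo this quadratic polynomial.
\<close>

lemma inj_add_square_divide_cubic:
  fixes e :: 'a
  assumes nr: "\<And>x. x ^ 3 + x ^ 2 + e \<noteq> 0"
  shows "inj (\<lambda>x. x + x ^ 2 / (x ^ 3 + x ^ 2 + e))"
proof (rule injI, rule ccontr)
  fix x y :: 'a
  assume eq: "x + x ^ 2 / (x ^ 3 + x ^ 2 + e) = y + y ^ 2 / (y ^ 3 + y ^ 2 + e)" and "x \<noteq> y"
  let ?X = "x ^ 3 + x ^ 2 + e" and ?Y = "y ^ 3 + y ^ 2 + e"
  define b1 where "b1 = x ^ 2 + x * y + y ^ 2 - x - y"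
  define c1 where "c1 = e - x * y * (x + y)"
  have "(x * ?X + x ^ 2) * ?Y = (y * ?Y + y ^ 2) * ?X"
    using eq nr[of x] nr[of y] by (simp add: field_simps)
  \<comment> \<open>The difference of the two sides is antisymmetric in \<open>x\<close> and
    \<open>y\<close>, so \<open>x - y\<close> splits off.\<close>
  then have "(x - y) * (?X * ?Y - x ^ 2 * y ^ 2 + e * (x + y)) = 0"
    by algebra
  then have G: "?X * ?Y - x ^ 2 * y ^ 2 + e * (x + y) = 0"
    using \<open>x \<noteq> y\<close> by simp
  have "c1 ^ 2 + (x + y - 1) * b1 * c1 + x * y * b1 ^ 2 = 0 + 3 * (- (x ^ 2 * e) - x * y * e - y ^ 2 * e)"
    using G unfolding b1_def c1_def by algebra
  then have res: "c1 ^ 2 + (x + y - 1) * b1 * c1 + x * y * b1 ^ 2 = 0"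
    by (simp add: three_eq_0)
  have division: "t ^ 3 + t ^ 2 + e = (t ^ 2 - (x + y - 1) * t + x * y) * (t + x + y) + b1 * t + c1" for t
    unfolding b1_def c1_def by algebra
  show False
  proof (cases "b1 = 0")
    case True
    \<comment> \<open>The remainder is zero, so the cubic has the linear factor
      \<open>t + x + y\<close> and with it the root \<open>- (x + y)\<close>.\<close>
    then have "c1 = 0" using res by simp
    then show False using True division[of "- (x + y)"] nr by simp
  next
    case False
    \<comment> \<open>The root of the remainder \<open>b1 * t + c1\<close>. The quadratic at this
      point, times \<open>b1 ^ 2\<close>, is the resultant \<open>res\<close>, so \<open>t\<close>
      is a root of the cubic.\<close>
    define t where "t = - (c1 / b1)"
    have t: "b1 * t = - c1" using False by (simp add: t_def)
    have "b1 ^ 2 * (t ^ 2 - (x + y - 1) * t + x * y) = 0"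
      using res t by algebra
    then have "t ^ 2 - (x + y - 1) * t + x * y = 0" using False by simp
    then show False using t division[of t] nr by simp
  qed
qed

text \<open>Under \<open>x = 1 / y\<close> a root of the cubic becomes a solution of
  \<open>y + e * y ^ 3 = -1\<close>. So this additive map is not surjective, hence not injective on
  a finite field; a nonzero kernel element \<open>s\<close> gives \<open>e = - 1 / s ^ 2\<close> and
  \<open>g = 1 / s\<close>.\<close>

lemma ex_square_root_tr_1:
  fixes e :: 'a
  assumes nr: "\<And>x. x ^ 3 + x ^ 2 + e \<noteq> 0"
  obtains g where "e = - (g ^ 2)" "tr g = 1"
proof -
  have "e \<noteq> 0" using nr[of 0] by simp
  have "\<not> inj (\<lambda>y. y + e * y ^ 3)"
  proof
    assume "inj (\<lambda>y. y + e * y ^ 3)"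
    then have "surj (\<lambda>y. y + e * y ^ 3)"
      by (rule finite_UNIV_inj_surj[OF finite])
    from surjD[OF this, of "-1"] obtain y where y: "-1 = y + e * y ^ 3" ..
    have "y \<noteq> 0"
    proof
      assume "y = 0"
      then show False using y by simp
    qed
    then have u: "inverse y * y = 1" by simp
    have "inverse y ^ 3 + inverse y ^ 2 + e = inverse y ^ 3 * (1 + (y + e * y ^ 3))"
      using u by algebra
    also have "1 + (y + e * y ^ 3) = 0" unfolding y[symmetric] by simp
    finally show False using nr[of "inverse y"] by simp
  qed
  then obtain x y where xy: "x + e * x ^ 3 = y + e * y ^ 3" "x \<noteq> y"
    by (auto simp: inj_def)
  define s where "s = x - y"
  have "s \<noteq> 0" using xy(2) by (simp add: s_def)
  have "s * (1 + e * s ^ 2) = (x - y) + e * (x - y) ^ 3"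
    unfolding s_def by algebra
  also have "\<dots> = 0" using xy(1) by (simp add: cube_diff algebra_simps)
  finally have es: "e * s ^ 2 = -1"
    using \<open>s \<noteq> 0\<close> by (simp add: eq_neg_iff_add_eq_0 add.commute)
  define g where "g = 1 / s"
  have eg: "e = - (g ^ 2)"
    using es \<open>s \<noteq> 0\<close> by (simp add: g_def field_simps)
  have "g \<noteq> 0" using \<open>s \<noteq> 0\<close> by (simp add: g_def)
  have "tr g \<noteq> 0"
  proof
    assume "tr g = 0"
    \<comment> \<open>For trace zero, Hilbert 90 writes \<open>g\<close> as
      \<open>z ^ 3 - z\<close>, and then \<open>g / z\<close> is a root of the cubic.\<close>
    then obtain z where z: "g = z ^ 3 - z" using range_artin_schreier by blast
    have "z \<noteq> 0" using z \<open>g \<noteq> 0\<close> by auto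
    then have u: "inverse z * z = 1" by simp
    have "(g * inverse z) ^ 3 + (g * inverse z) ^ 2 + e = g ^ 2 * (g + z - z ^ 3) * inverse z ^ 3"
      unfolding eg using u by algebra
    then show False using nr[of "g * inverse z"] z by simp
  qed
  \<comment> \<open>A nonzero trace is 1 or -1, and \<open>e\<close> depends only on the square of
    \<open>g\<close>, so the sign of \<open>g\<close> is free.\<close>
  then have "tr g = 1 \<or> tr (- g) = 1"
    using cube_tr[of g] by (auto simp: cube_eq_self_iff tr_minus)
  then show ?thesis using that[of g] that[of "- g"] eg by auto
qed

end

section \<open>Necessity of \<open>a = 1\<close>, \<open>b = c = 0\<close> for
  \<open>n > 4\<close>\<close>

context trace_one
begin

lemma bij_imp_coefficients:
  fixes a b c :: 'a
  defines "h \<equiv> \<lambda>x. x + (a * x ^ 2 + b * x + c) / (x ^ 3 + x ^ 2 - g ^ 2)"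
  assumes bij: "bij h" and nz: "\<not> (a = 0 \<and> b = 0 \<and> c = 0)"
  shows "a = 1 \<and> b = 0 \<and> c = 0"
proof -
  define \<beta> \<gamma> where "\<beta> = b / g" and "\<gamma> = c / g ^ 2"
  have b: "b = \<beta> * g" and c: "c = \<gamma> * g ^ 2"
    using g_neq_0 by (simp_all add: \<beta>_def \<gamma>_def)
  have card_gt: "8 < CARD('a) - 1"
  proof -
    have "(3::nat) ^ 3 \<le> 3 ^ n" using n_ge by (intro power_increasing) auto
    then show ?thesis by (simp add: card)
  qed
  have h_sub: "h (g / z) = g / z - (a * z + \<beta> * z ^ 2 + \<gamma> * z ^ 3) / D z" if "z \<noteq> 0" for z
  proof -
    have u: "inverse z * z = 1" using that by simp
    \<comment> \<open>The common factor of numerator and denominator after substituting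
      \<open>g / z\<close>; the scaling of \<open>\<beta>\<close> and \<open>\<gamma>\<close>
      removes the remaining powers of \<open>g\<close>, and the denominator becomes
      \<open>- D z\<close>.\<close>
    define k where "k = g ^ 2 * inverse z ^ 3"
    have "k \<noteq> 0" using that g_neq_0 by (simp add: k_def)
    have "(g * inverse z) ^ 3 + (g * inverse z) ^ 2 - g ^ 2 = k * (- D z)"
      unfolding D_def k_def using u by algebra
    moreover have "a * (g * inverse z) ^ 2 + b * (g * inverse z) + c = k * (a * z + \<beta> * z ^ 2 + \<gamma> * z ^ 3)"
      unfolding b c k_def using u by algebra
    ultimately have "h (g * inverse z) = g * inverse z + (a * z + \<beta> * z ^ 2 + \<gamma> * z ^ 3) / (- D z)"
      unfolding h_def by (simp only: mult_divide_mult_cancel_left[OF \<open>k \<noteq> 0\<close>])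
    then show ?thesis by (simp add: divide_inverse)
  qed
  have h_0: "h 0 = - \<gamma>"
    using g_neq_0 by (simp add: h_def c)
  have reindex: "(\<Sum>z\<in>UNIV - {0}. F (g / z)) = (\<Sum>x\<in>UNIV - {0}. F x)" for F :: "'a \<Rightarrow> 'a"
    by (rule sum.reindex_bij_witness[of _ "\<lambda>x. g / x" "\<lambda>z. g / z"]) (use g_neq_0 in auto)
  have bij_sum: "(\<Sum>x\<in>UNIV. F (h x)) = (\<Sum>x\<in>UNIV. F x)" for F :: "'a \<Rightarrow> 'a"
    using sum.reindex_bij_betw[OF bij] .
  \<comment> \<open>Exponent 1: the point 0 contributes \<open>- \<gamma>\<close>, and among the
    sums over nonzero \<open>z\<close> only the one with \<open>T 2 1 = 1\<close> survives.\<close>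
  have "\<gamma> = - \<beta>"
  proof -
    have "0 = (\<Sum>x\<in>UNIV. h x)"
      using bij_sum[of "\<lambda>x. x"] sum_power_eq_0[where 'a = 'a, of 1] card_gt by simp
    also have "\<dots> = h 0 + (\<Sum>x\<in>UNIV - {0}. h x)"
      by (rule sum.remove) auto
    also have "(\<Sum>x\<in>UNIV - {0}. h x) = (\<Sum>z\<in>UNIV - {0}. h (g / z))"
      by (rule reindex[symmetric])
    also have "\<dots> = (\<Sum>z\<in>UNIV - {0}. g * mono (-1) 0 z - a * mono 1 1 z - \<beta> * mono 2 1 z - \<gamma> * mono 3 1 z)"
    proof (rule sum.cong)
      fix z :: 'a assume "z \<in> UNIV - {0}"
      then have z: "z \<noteq> 0" by simp
      then show "h (g / z) = g * mono (-1) 0 z - a * mono 1 1 z - \<beta> * mono 2 1 z - \<gamma> * mono 3 1 z"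
        unfolding h_sub[OF z] by (simp add: mono_def power_int_minus divide_inverse algebra_simps)
    qed simp
    also have "\<dots> = - \<beta>"
      unfolding sum_subtractf sum_mono using T_1[of 1] T_2_1 T_3[of 1] T_neg_0(1) by simp
    finally have "0 = - \<gamma> + - \<beta>" unfolding h_0 .
    then show ?thesis by algebra
  qed
  have phi: "phi (- \<beta>) (\<beta> - a) (\<beta> * g) z = h (g / z) - \<beta>" if "z \<noteq> 0" for z
  proof -
    have "\<beta> = \<beta> * D z / D z" using D_neq_0[of z] by simp
    then have "h (g / z) - \<beta> = g / z + (- (a * z + \<beta> * z ^ 2 - \<beta> * z ^ 3) - \<beta> * D z) / D z"
      unfolding h_sub[OF that] \<open>\<gamma> = - \<beta>\<close> by (simp add: diff_divide_distrib add_divide_distrib)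
    also have "- (a * z + \<beta> * z ^ 2 - \<beta> * z ^ 3) - \<beta> * D z = - \<beta> * z ^ 2 + (\<beta> - a) * z + \<beta> * g"
      unfolding D_def by algebra
    finally show ?thesis by (simp add: phi_def)
  qed
  have power_sum: "(\<Sum>z\<in>UNIV - {0}. phi (- \<beta>) (\<beta> - a) (\<beta> * g) z ^ k) = 0" if k: "0 < k" "k \<le> 8" for k
  proof -
    have "(\<Sum>z\<in>UNIV - {0}. phi (- \<beta>) (\<beta> - a) (\<beta> * g) z ^ k) = (\<Sum>z\<in>UNIV - {0}. (h (g / z) - \<beta>) ^ k)"
      by (rule sum.cong) (auto simp: phi)
    also have "\<dots> = (\<Sum>x\<in>UNIV - {0}. (h x - \<beta>) ^ k)"
      by (rule reindex)
    \<comment> \<open>The point \<open>x = 0\<close> may be added because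
      \<open>h 0 = \<beta>\<close>, so its term is a positive power of zero.\<close>
    also have "\<dots> = (\<Sum>x\<in>UNIV. (h x - \<beta>) ^ k)"
      by (rule sum.mono_neutral_left) (use k(1) in \<open>auto simp: h_0 \<open>\<gamma> = - \<beta>\<close>\<close>)
    also have "\<dots> = (\<Sum>x\<in>UNIV. (x - \<beta>) ^ k)"
      by (rule bij_sum)
    also have "\<dots> = (\<Sum>x\<in>UNIV. x ^ k)"
      by (rule sum.reindex_bij_witness[of _ "\<lambda>x. x + \<beta>" "\<lambda>x. x - \<beta>"]) auto
    also have "\<dots> = 0"
      using k card_gt by (intro sum_power_eq_0) auto
    finally show ?thesis .
  qed
  note rel2 = phi_relation_2[OF power_sum[of 2, simplified]]
    and rel4 = phi_relation_4[OF power_sum[of 4, simplified]]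
    and rel5 = phi_relation_5[OF power_sum[of 5, simplified]]
    and rel7 = phi_relation_7[OF power_sum[of 7, simplified]]
  \<comment> \<open>Exponent 2 in factored form; it determines \<open>g\<close> by \<open>a\<close>
    and \<open>\<beta>\<close> unless \<open>\<beta>\<close> is 0 or -1.\<close>
  have g: "\<beta> * (\<beta> + 1) * g = - (a * (a + \<beta> - 1))"
    using rel2 by algebra
  have "\<beta> = 0"
  proof (rule ccontr)
    assume "\<beta> \<noteq> 0"
    show False
    proof (cases "\<beta> + 1 = 0")
      \<comment> \<open>Here the exponent 2 relation says nothing about \<open>g\<close>, but it
        restricts \<open>a\<close> to 0 and -1; exponents 4 and 5 rule out both.\<close>
      case True
      then have \<beta>: "\<beta> = - 1" by (simp add: eq_neg_iff_add_eq_0)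
      have "a * (a + 1) = 3 * a + 0" using g unfolding \<beta> by algebra
      then have "a = 0 \<or> a = - 1" by (simp add: three_eq_0 eq_neg_iff_add_eq_0)
      then show False
      proof
        assume a: "a = 0"
        have "g ^ 2 - 2 * g ^ 3 = 0" using rel4 unfolding a \<beta> by simp
        then have "g ^ 2 * (g + 1) = 0" unfolding two_eq_minus_one by algebra
        then have g1: "g = - 1" using g_neq_0 by (simp add: eq_neg_iff_add_eq_0)
        have "4 = (0::'a)" using rel5 unfolding a \<beta> g1 by simp
        moreover have "(4::'a) = 3 + 1" by simp
        ultimately show False by (simp only: three_eq_0) simp
      next
        assume a: "a = - 1"
        have "g ^ 4 = 0 + 3 * (- g - g ^ 2)" using rel5 unfolding a \<beta> by algebra
        then show False using g_neq_0 by (simp add: three_eq_0)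
      qed
    next
      case False
      \<comment> \<open>Since the left side of \<open>g\<close> is nonzero, so are the factors
        \<open>a\<close> and \<open>a + \<beta> - 1\<close> on the right, as the elimination
        requires.\<close>
      have "\<beta> * (\<beta> + 1) * g \<noteq> 0" using \<open>\<beta> \<noteq> 0\<close> False g_neq_0 by simp
      then have "a \<noteq> 0" "a + \<beta> - 1 \<noteq> 0" unfolding g by simp_all
      note nz' = this(1) \<open>\<beta> \<noteq> 0\<close> this(2)
      show False
        using no_common_zero[OF nz'(1,2) False nz'(3)
            eliminate_g_4[OF g nz' rel4] eliminate_g_5[OF g nz' rel5] eliminate_g_7[OF g nz' rel7]] .
    qed
  qed
  then have "b = 0" "c = 0" by (simp_all add: b c \<open>\<gamma> = - \<beta>\<close>)
  \<comment> \<open>For \<open>\<beta> = 0\<close> the exponent 2 relation leaves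
    \<open>a = 0\<close> or \<open>a = 1\<close>; the first would make all three coefficients
    zero.\<close>
  moreover have "a * (a - 1) = 0" using g \<open>\<beta> = 0\<close> by simp
  ultimately show ?thesis using nz by simp
qed

end

theorem theorem4p1:
  fixes a b c e :: "'a::{field, finite}"
    and n :: nat
    and f :: "'a poly fract"
  assumes "n \<ge> 1"
    and "CARD('a) = 3 ^ n"
    and "f = Fract [:0, 1:] 1 + Fract [:c, b, a:] [:e, 0, 1, 1:]"
    and "\<not> (a = 0 \<and> b = 0 \<and> c = 0)"
    and "irreducible [:e, 0, 1, 1:]"
  shows "(n > 4 \<longrightarrow> (permutation_ratfun f \<longleftrightarrow> a = 1 \<and> b = 0 \<and> c = 0)) \<and>
         (a = 1 \<and> b = 0 \<and> c = 0 \<longrightarrow> permutation_ratfun f)"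
proof -
  interpret ternary_field n "TYPE('a)"
    using assms(1,2) by unfold_locales auto
  let ?Q = "[:e, 0, 1, 1:]" and ?P = "[:c, e + b, a, 1, 1:]"
  have P: "?P = [:0, 1:] * ?Q + [:c, b, a:]" by simp
  have f: "f = Fract ?P ?Q"
    unfolding assms(3) P by (subst add_fract) simp_all
  have poly_Q: "poly ?Q x = x ^ 3 + x ^ 2 + e" for x
    by (simp add: algebra_simps power2_eq_square power3_eq_cube)
  have nr: "x ^ 3 + x ^ 2 + e \<noteq> 0" for x
    using irreducible_no_root[OF assms(5), of x] unfolding poly_Q by simp
  have "\<not> ?Q dvd [:c, b, a:]"
  proof
    assume "?Q dvd [:c, b, a:]"
    \<comment> \<open>The cubic cannot divide a polynomial of degree at most two; that polynomial is
      nonzero because \<open>a\<close>, \<open>b\<close>, \<open>c\<close> are not all 0.\<close>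
    then have "degree ?Q \<le> degree [:c, b, a:]"
      using assms(4) by (intro dvd_imp_degree_le) auto
    then show False by (simp split: if_splits)
  qed
  then have "\<not> ?Q dvd ?P" unfolding P by (simp only: dvd_add_right_iff dvd_triv_right not_False_eq_True)
  then have "coprime ?P ?Q" by (rule irreducible_coprime[OF assms(5)])
  then have "permutation_ratfun f \<longleftrightarrow> bij (\<lambda>x. poly ?P x / poly ?Q x)"
    unfolding f by (rule permutation_ratfun_iff_bij) (simp_all only: poly_Q nr, simp_all)
  moreover have "poly ?P x / poly ?Q x = x + (a * x ^ 2 + b * x + c) / (x ^ 3 + x ^ 2 + e)" for x
  proof -
    have "poly ?P x = x * (x ^ 3 + x ^ 2 + e) + (a * x ^ 2 + b * x + c)"
      by (simp add: algebra_simps power2_eq_square power3_eq_cube)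
    then show ?thesis unfolding poly_Q using nr[of x] by (simp add: add_divide_distrib)
  qed
  ultimately have iff: "permutation_ratfun f \<longleftrightarrow>
      bij (\<lambda>x. x + (a * x ^ 2 + b * x + c) / (x ^ 3 + x ^ 2 + e))" by simp
  have "permutation_ratfun f" if "a = 1 \<and> b = 0 \<and> c = 0"
    unfolding iff using inj_add_square_divide_cubic[OF nr] finite_UNIV_inj_surj[OF finite] that by (simp add: bij_def)
  moreover have "a = 1 \<and> b = 0 \<and> c = 0" if "n > 4" "permutation_ratfun f"
  proof -
    obtain g where g: "e = - (g ^ 2)" "tr g = 1"
      using ex_square_root_tr_1[OF nr] .
    interpret trace_one n "TYPE('a)" g
      using g(2) that(1) by unfold_locales simp_all
    show ?thesis
      using that(2) assms(4) unfolding iff g(1) by (intro bij_imp_coefficients) simp_all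
  qed
  ultimately show ?thesis by blast
qed

end
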